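(* Let $k$ be a field of characteristic zero, $n\ge 1$, let $\mathbf{p}\subset\{1,\dots,n\}$, and define $q_{1j}=\chi_{\mathbf{p}}(j)$ and $q_{2j}=0$ for $j=1,\dots,n$, where $\chi_{\mathbf{p}}$ is the characteristic function of $\mathbf{p}$ (value $1$ on $\mathbf{p}$, $0$ elsewhere). Consider the Hopf algebra structure on the symmetric algebra $S(T_n)$ on rooted trees with $n$-coloured edges corresponding to this choice of $q_{ij}$ (see context). \begin{enumerate} \item[(i)] The product \[ D_t\bullet D_s=\sum_w\ \sum_{s\subset w,\ s^c=t}q(s,w)\,D_w \] (where $w$ ranges over all $n$-coloured rooted trees, and the second sum is over subtrees of $w$ isomorphic to $s$ whose complement is isomorphic to $t$) defines a pre-Lie algebra structure on the space $P(S(T_n)^* )$ of primitive elements of the graded dual $S(T_n)^*$. \item[(ii)] If $\mathbf{p}=\{1,\dots,n\}$, then there is a natural inclusion (injective homomorphism of pre-Lie algebras) of this pre-Lie algebra into the free pre-Lie algebra $L_n$ on $n$ generators. The image in $L_n$ is spanned by all sums $\sum_{i\in\mathbf{p}}t_i$ of trees $t_i$ with vertices coloured by $\mathbf{p}$ that only differ in that the colour of the root of $t_i$ is $i$. \end{enumerate}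
   Context: A rooted tree is an isomorphism class of finite posets which have a minimum element (the root), and in which $y\neq z$, $y<x$, $z<x$ imply $y<z$ or $z<y$. Elements are called vertices; a pair $v<w$ with no $x$ satisfying $v<x<w$ is called an edge, with lower vertex $v$. An $n$-coloured tree is an isomorphism class of such posets equipped with a function from the set of edges to $\{1,\dots,n\}$. $T_n$ is the $k$-vector space with basis the set of $n$-coloured trees. An $n$-coloured forest is a finite, possibly empty, multiset of $n$-coloured trees. $S(T_n)$ has as basis the $n$-coloured forests, with product the disjoint union; it is graded by the number of vertices. $S(T_n)^*$ is the graded linear dual, with the dual Hopf algebra structure; $D_u$ is the element dual to the forest $u$ with respect to the basis of forests. The space of primitive elements $P(S(T_n)^* )$ has as basis the $D_t$ with $t$ an $n$-coloured tree. A subforest $s$ of a forest $t$ is a subset of the vertices with the induced partial order, coloured as follows: an edge $v<w$ of $s$ gets the colour of the first edge (the one with lower vertex $v$) on the upward path from $v$ to $w$ in $t$. A subtree is a subforest that is a tree. $s^c$ is the complementary subforest. For a tree $t$, $s\subset t$ and $v\in s$, $p_j(v,s,t)$ is the number of edges of colour $j$ in the path in $t$ from $v$ to the root of $t$ whose lower vertex lies in $s^c$; for a forest $t$, $p_j(v,s,t):=p_j(v,s\cap t',t')$ with $t'$ the connected component of $t$ containing $v$. Put \[ q(s,t):=\prod_{j=1}^n\Big(\prod_{v\in s}q_{1j}^{\,p_j(v,s,t)}\cdot\prod_{v\in s^c}q_{2j}^{\,p_j(v,s^c,t)}\Big), \] with the convention $q^0=1$ for all $q\in k$, including $q=0$.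 The Hopf algebra structure on $S(T_n)$ corresponding to the $q_{ij}$ is the graded connected one with coproduct $\Delta(t)=\sum_{s\subset t}q(s,t)\,s\otimes s^c$ for every forest $t$, the sum being over all subforests of $t$. A pre-Lie algebra is a vector space $L$ with a bilinear operation $\bullet$ such that $(x\bullet y)\bullet z-x\bullet(y\bullet z)=(x\bullet z)\bullet y-x\bullet(z\bullet y)$. The free pre-Lie algebra $L_n$ on $n$ generators is the vector space spanned by rooted trees with vertices labelled (coloured) by elements of $\{1,\dots,n\}$, with product $t\bullet s=\sum_{v\in t}t\circ_v s$, where $t\circ_v s$ is obtained by attaching the root of $s$ to the vertex $v$ of $t$ by a new edge, preserving the labels of the vertices. *)

theory Defs
  imports
    Complex_Main
    "HOL-Library.Multiset"
    "HOL-Library.Poly_Mapping"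
    "HOL-Library.Function_Algebras"
begin

section \<open>Finite posets, trees and forests\<close>

text \<open>
  Concrete posets have vertices in \<^typ>\<open>nat\<close>, which loses nothing up to isomorphism.
  The relation \<open>le\<close> is the reflexive order.  The set of \<open>n\<close> colours is a type
  \<open>'c\<close> of class \<^class>\<open>finite\<close>, with \<open>n\<close> its cardinality.
\<close>

record poset =
  verts :: "nat set"
  le :: "nat rel"

record 'c epos = poset +
  ecol :: "nat \<Rightarrow> nat \<Rightarrow> 'c"  \<comment> \<open>relevant only on edges\<close>

record 'c vpos = poset +
  vcol :: "nat \<Rightarrow> 'c"  \<comment> \<open>relevant only on vertices\<close>

definition edge :: "'z poset_scheme \<Rightarrow> nat \<Rightarrow> nat \<Rightarrow> bool" where
  "edge X v w \<longleftrightarrow> (v, w) \<in> le X \<and> v \<noteq> w \<and>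
     \<not> (\<exists>x. (v, x) \<in> le X \<and> v \<noteq> x \<and> (x, w) \<in> le X \<and> x \<noteq> w)"

text \<open>A forest is a finite disjoint union of rooted trees; as a poset this drops
  the minimum element from the definition of a rooted tree.\<close>

definition is_forest :: "'z poset_scheme \<Rightarrow> bool" where
  "is_forest X \<longleftrightarrow> finite (verts X) \<and> partial_order_on (verts X) (le X) \<and>
     (\<forall>x y z. y \<noteq> z \<and> (y, x) \<in> le X \<and> y \<noteq> x \<and> (z, x) \<in> le X \<and> z \<noteq> x
        \<longrightarrow> (y, z) \<in> le X \<or> (z, y) \<in> le X)"

definition is_tree :: "'z poset_scheme \<Rightarrow> bool" where
  "is_tree X \<longleftrightarrow> is_forest X \<and> (\<exists>r\<in>verts X. \<forall>x\<in>verts X. (r, x) \<in> le X)"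

definition root :: "'z poset_scheme \<Rightarrow> nat" where
  "root X = (THE r. r \<in> verts X \<and> (\<forall>x\<in>verts X. (r, x) \<in> le X))"

definition poset_iso ::
    "(nat \<Rightarrow> nat) \<Rightarrow> 'y poset_scheme \<Rightarrow> 'z poset_scheme \<Rightarrow> bool" where
  "poset_iso f X Y \<longleftrightarrow> bij_betw f (verts X) (verts Y) \<and>
     (\<forall>x\<in>verts X. \<forall>y\<in>verts X. (x, y) \<in> le X \<longleftrightarrow> (f x, f y) \<in> le Y)"

definition epos_iso :: "'c epos \<Rightarrow> 'c epos \<Rightarrow> bool" where
  "epos_iso X Y \<longleftrightarrow> (\<exists>f. poset_iso f X Y \<and>
     (\<forall>v w. edge X v w \<longrightarrow> ecol X v w = ecol Y (f v) (f w)))"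

definition vpos_iso :: "'c vpos \<Rightarrow> 'c vpos \<Rightarrow> bool" where
  "vpos_iso X Y \<longleftrightarrow> (\<exists>f. poset_iso f X Y \<and> (\<forall>v\<in>verts X. vcol X v = vcol Y (f v)))"

lemma poset_iso_id: "poset_iso id X X"
  by (simp add: poset_iso_def)

lemma poset_iso_comp: "poset_iso f X Y \<Longrightarrow> poset_iso g Y Z \<Longrightarrow> poset_iso (g \<circ> f) X Z"
  unfolding poset_iso_def by (auto intro: bij_betw_trans dest: bij_betwE)

lemma poset_iso_inv:
  assumes "poset_iso f X Y"
  shows "poset_iso (inv_into (verts X) f) Y X"
proof -
  have b: "bij_betw f (verts X) (verts Y)" using assms by (simp add: poset_iso_def)
  have "inv_into (verts X) f y \<in> verts X" "f (inv_into (verts X) f y) = y"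
    if "y \<in> verts Y" for y
    using b that by (auto simp: bij_betw_def inv_into_into f_inv_into_f)
  then show ?thesis
    using assms bij_betw_inv_into[OF b] unfolding poset_iso_def by metis
qed

lemma edge_verts: "is_tree X \<Longrightarrow> edge X v w \<Longrightarrow> v \<in> verts X \<and> w \<in> verts X"
  unfolding is_tree_def is_forest_def partial_order_on_def preorder_on_def edge_def by blast

lemma poset_iso_edge:
  assumes "poset_iso f X Y" "is_tree X" "is_tree Y" "edge X v w"
  shows "edge Y (f v) (f w)"
proof -
  have b: "bij_betw f (verts X) (verts Y)"
    and o: "\<And>x y. x \<in> verts X \<Longrightarrow> y \<in> verts X \<Longrightarrow> (x, y) \<in> le X \<longleftrightarrow> (f x, f y) \<in> le Y"
    using assms(1) by (auto simp: poset_iso_def)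
  have vw: "v \<in> verts X" "w \<in> verts X" using edge_verts assms by blast+
  have sub: "le Y \<subseteq> verts Y \<times> verts Y"
    using assms(3) by (simp add: is_tree_def is_forest_def partial_order_on_def preorder_on_def)
  show ?thesis
    unfolding edge_def
  proof (intro conjI notI)
    show "(f v, f w) \<in> le Y" using o vw assms(4) by (simp add: edge_def)
    show False if "f v = f w"
      using that b vw assms(4) by (auto simp: edge_def bij_betw_def inj_on_def)
    assume "\<exists>x. (f v, x) \<in> le Y \<and> f v \<noteq> x \<and> (x, f w) \<in> le Y \<and> x \<noteq> f w"
    then obtain y where y: "(f v, y) \<in> le Y" "f v \<noteq> y" "(y, f w) \<in> le Y" "y \<noteq> f w" by blast
    then obtain x where "x \<in> verts X" "y = f x"
      using sub b by (auto simp: bij_betw_def)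
    then have "(v, x) \<in> le X" "v \<noteq> x" "(x, w) \<in> le X" "x \<noteq> w"
      using y o vw by auto
    then show False using assms(4) by (auto simp: edge_def)
  qed
qed

quotient_type 'c etree = "'c epos" / partial: "\<lambda>X Y. is_tree X \<and> is_tree Y \<and> epos_iso X Y"
proof (rule part_equivpI)
  let ?X = "\<lparr>verts = {0}, le = {(0, 0)}, ecol = \<lambda>_ _. undefined\<rparr> :: 'c epos"
  have "is_tree ?X"
    by (auto simp: is_tree_def is_forest_def partial_order_on_def preorder_on_def
        refl_on_def trans_def antisym_def)
  moreover have "epos_iso ?X ?X"
    unfolding epos_iso_def by (rule exI[of _ id]) (simp add: poset_iso_id)
  ultimately show "\<exists>X :: 'c epos. is_tree X \<and> is_tree X \<and> epos_iso X X" by blast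
  show "symp (\<lambda>X Y :: 'c epos. is_tree X \<and> is_tree Y \<and> epos_iso X Y)"
  proof (rule sympI, safe)
    fix X Y :: "'c epos"
    assume t: "is_tree X" "is_tree Y" and "epos_iso X Y"
    then obtain f where f: "poset_iso f X Y"
      and c: "\<And>v w. edge X v w \<Longrightarrow> ecol X v w = ecol Y (f v) (f w)"
      by (auto simp: epos_iso_def)
    let ?g = "inv_into (verts X) f"
    have g: "poset_iso ?g Y X" using f by (rule poset_iso_inv)
    have fg: "f (?g y) = y" if "y \<in> verts Y" for y
      using f that by (auto simp: poset_iso_def bij_betw_def f_inv_into_f)
    have "ecol Y v w = ecol X (?g v) (?g w)" if "edge Y v w" for v w
      using c[OF poset_iso_edge[OF g t(2) t(1) that]] edge_verts[OF t(2) that] fg by simp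
    with g show "epos_iso Y X" by (auto simp: epos_iso_def)
  qed
  show "transp (\<lambda>X Y :: 'c epos. is_tree X \<and> is_tree Y \<and> epos_iso X Y)"
  proof (rule transpI, safe)
    fix X Y Z :: "'c epos"
    assume t: "is_tree X" "is_tree Y" "is_tree Z" and "epos_iso X Y" "epos_iso Y Z"
    then obtain f g where f: "poset_iso f X Y" "poset_iso g Y Z"
      and c: "\<And>v w. edge X v w \<Longrightarrow> ecol X v w = ecol Y (f v) (f w)"
        "\<And>v w. edge Y v w \<Longrightarrow> ecol Y v w = ecol Z (g v) (g w)"
      by (auto simp: epos_iso_def)
    have "ecol X v w = ecol Z ((g \<circ> f) v) ((g \<circ> f) w)" if "edge X v w" for v w
      using c(1)[OF that] c(2)[OF poset_iso_edge[OF f(1) t(1) t(2) that]] by simp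
    with poset_iso_comp[OF f] show "epos_iso X Z" by (auto simp: epos_iso_def)
  qed
qed

quotient_type 'c vtree = "'c vpos" / partial: "\<lambda>X Y. is_tree X \<and> is_tree Y \<and> vpos_iso X Y"
proof (rule part_equivpI)
  let ?X = "\<lparr>verts = {0}, le = {(0, 0)}, vcol = \<lambda>_. undefined\<rparr> :: 'c vpos"
  have "is_tree ?X"
    by (auto simp: is_tree_def is_forest_def partial_order_on_def preorder_on_def
        refl_on_def trans_def antisym_def)
  moreover have "vpos_iso ?X ?X"
    unfolding vpos_iso_def by (rule exI[of _ id]) (simp add: poset_iso_id)
  ultimately show "\<exists>X :: 'c vpos. is_tree X \<and> is_tree X \<and> vpos_iso X X" by blast
  show "symp (\<lambda>X Y :: 'c vpos. is_tree X \<and> is_tree Y \<and> vpos_iso X Y)"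
  proof (rule sympI, safe)
    fix X Y :: "'c vpos"
    assume "vpos_iso X Y"
    then obtain f where f: "poset_iso f X Y"
      and c: "\<And>v. v \<in> verts X \<Longrightarrow> vcol X v = vcol Y (f v)"
      by (auto simp: vpos_iso_def)
    let ?g = "inv_into (verts X) f"
    have "f (?g y) = y" "?g y \<in> verts X" if "y \<in> verts Y" for y
      using f that by (auto simp: poset_iso_def bij_betw_def f_inv_into_f inv_into_into)
    with c poset_iso_inv[OF f] show "vpos_iso Y X" by (auto simp: vpos_iso_def)
  qed
  show "transp (\<lambda>X Y :: 'c vpos. is_tree X \<and> is_tree Y \<and> vpos_iso X Y)"
  proof (rule transpI, safe)
    fix X Y Z :: "'c vpos"
    assume "vpos_iso X Y" "vpos_iso Y Z"
    then obtain f g where f: "poset_iso f X Y" "poset_iso g Y Z"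
      and c: "\<And>v. v \<in> verts X \<Longrightarrow> vcol X v = vcol Y (f v)"
        "\<And>v. v \<in> verts Y \<Longrightarrow> vcol Y v = vcol Z (g v)"
      by (auto simp: vpos_iso_def)
    have "f v \<in> verts Y" if "v \<in> verts X" for v
      using f(1) that by (auto simp: poset_iso_def bij_betw_def)
    with c poset_iso_comp[OF f] show "vpos_iso X Z" by (auto simp: vpos_iso_def)
  qed
qed

text \<open>\<open>'c etree\<close> is the type of \<open>n\<close>-coloured trees, \<open>'c vtree\<close> that of
  rooted trees with vertices labelled in \<open>'c\<close>.  Below, \<open>rep_etree w\<close> and
  \<open>rep_vtree t\<close> choose a poset in the isomorphism class; every
  construction using them is independent of the choice.\<close>

type_synonym 'c eforest = "'c etree multiset"

section \<open>Subforests and the coefficients \<open>q(s,t)\<close>\<close>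

definition subforest :: "'c epos \<Rightarrow> nat set \<Rightarrow> 'c epos" where
  "subforest X A = \<lparr>verts = A, le = Restr (le X) A,
     ecol = (\<lambda>v w. ecol X v (THE u. edge X v u \<and> (u, w) \<in> le X))\<rparr>"

definition compl_in :: "'c epos \<Rightarrow> nat set \<Rightarrow> nat set" where
  "compl_in X A = verts X - A"

text \<open>The isomorphism class of a concrete forest: its connected components are the up-sets
  of its minimal vertices.\<close>

definition eforest_of :: "'c epos \<Rightarrow> 'c eforest" where
  "eforest_of X =
     {# abs_etree (subforest X {x. (r, x) \<in> le X}).
        r \<in># mset_set {r \<in> verts X. \<forall>x. (x, r) \<in> le X \<longrightarrow> x = r} #}"

definition rep_eforest :: "'c eforest \<Rightarrow> 'c epos" where
  "rep_eforest u = (SOME X. is_forest X \<and> eforest_of X = u)"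

text \<open>The vertices below \<open>v\<close> form a chain from \<open>v\<close> to the root of the component of \<open>v\<close>,
  so the edges on the path from \<open>v\<close> to that root are the edges whose upper vertex
  is at most \<open>v\<close>.\<close>

definition pnum :: "'c \<Rightarrow> nat \<Rightarrow> nat set \<Rightarrow> 'c epos \<Rightarrow> nat" where
  "pnum j v A X =
     card {(a, b). edge X a b \<and> (b, v) \<in> le X \<and> ecol X a b = j \<and> a \<in> compl_in X A}"

definition qcoeff ::
    "('c::finite \<Rightarrow> 'k::field) \<Rightarrow> ('c \<Rightarrow> 'k) \<Rightarrow> nat set \<Rightarrow> 'c epos \<Rightarrow> 'k" where
  "qcoeff q1 q2 A X = (\<Prod>j\<in>UNIV.
     (\<Prod>v\<in>A. q1 j ^ pnum j v A X) *
     (\<Prod>v\<in>compl_in X A. q2 j ^ pnum j v (compl_in X A) X))"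

section \<open>Vector spaces with a basis and their graded duals\<close>

definition pscale :: "'k::field \<Rightarrow> ('b \<Rightarrow>\<^sub>0 'k) \<Rightarrow> ('b \<Rightarrow>\<^sub>0 'k)" where
  "pscale c x = Poly_Mapping.map ((*) c) x"

definition basis :: "'b \<Rightarrow> ('b \<Rightarrow>\<^sub>0 'k::field)" where
  "basis b = Poly_Mapping.single b 1"

definition lin_ext :: "('b \<Rightarrow> ('d \<Rightarrow>\<^sub>0 'k::field)) \<Rightarrow> ('b \<Rightarrow>\<^sub>0 'k) \<Rightarrow> ('d \<Rightarrow>\<^sub>0 'k)" where
  "lin_ext f x = (\<Sum>b\<in>Poly_Mapping.keys x. pscale (Poly_Mapping.lookup x b) (f b))"

definition fscale :: "'k::field \<Rightarrow> ('v \<Rightarrow> 'k) \<Rightarrow> ('v \<Rightarrow> 'k)" where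
  "fscale c \<xi> = (\<lambda>x. c * \<xi> x)"

text \<open>Structure maps of a graded connected Hopf algebra \<open>H\<close> with homogeneous basis \<open>'b\<close>;
  \<open>H \<otimes> H\<close> is the space with basis \<open>'b \<times> 'b\<close>.  The antipode is determined
  by these data.\<close>

record (overloaded) ('b, 'k) hopf_data =
  hmult :: "('b \<times> 'b \<Rightarrow>\<^sub>0 'k) \<Rightarrow> ('b \<Rightarrow>\<^sub>0 'k)"
  hunit :: "'b \<Rightarrow>\<^sub>0 'k"
  hcomult :: "('b \<Rightarrow>\<^sub>0 'k) \<Rightarrow> ('b \<times> 'b \<Rightarrow>\<^sub>0 'k)"
  hcounit :: "('b \<Rightarrow>\<^sub>0 'k) \<Rightarrow> 'k"
  hdeg :: "'b \<Rightarrow> nat"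

definition graded_dual :: "('b, 'k::field) hopf_data \<Rightarrow> (('b \<Rightarrow>\<^sub>0 'k) \<Rightarrow> 'k) set" where
  "graded_dual H = {\<xi>. Vector_Spaces.linear pscale (*) \<xi> \<and>
     (\<exists>N. \<forall>b. N < hdeg H b \<longrightarrow> \<xi> (basis b) = 0)}"

definition tensor ::
    "(('b \<Rightarrow>\<^sub>0 'k) \<Rightarrow> 'k) \<Rightarrow> (('b \<Rightarrow>\<^sub>0 'k) \<Rightarrow> 'k) \<Rightarrow> ('b \<times> 'b \<Rightarrow>\<^sub>0 'k::field) \<Rightarrow> 'k" where
  "tensor \<xi> \<eta> = (\<lambda>x. \<Sum>(a, b)\<in>Poly_Mapping.keys x.
     Poly_Mapping.lookup x (a, b) * (\<xi> (basis a) * \<eta> (basis b)))"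

text \<open>The comultiplication of the dual Hopf algebra is the transpose of the multiplication,
  with values in functionals on \<open>H \<otimes> H\<close>, and its unit is the counit of \<open>H\<close>.\<close>

definition dual_comult ::
    "('b, 'k::field) hopf_data \<Rightarrow> (('b \<Rightarrow>\<^sub>0 'k) \<Rightarrow> 'k) \<Rightarrow> (('b \<times> 'b \<Rightarrow>\<^sub>0 'k) \<Rightarrow> 'k)" where
  "dual_comult H \<xi> = (\<lambda>x. \<xi> (hmult H x))"

definition dual_primitives :: "('b, 'k::field) hopf_data \<Rightarrow> (('b \<Rightarrow>\<^sub>0 'k) \<Rightarrow> 'k) set" where
  "dual_primitives H = {\<xi> \<in> graded_dual H.
     dual_comult H \<xi> = tensor \<xi> (hcounit H) + tensor (hcounit H) \<xi>}"

section \<open>The Hopf algebra \<open>S(T\<^sub>n)\<close>\<close>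

definition tree_hopf ::
    "('c::finite \<Rightarrow> 'k::field) \<Rightarrow> ('c \<Rightarrow> 'k) \<Rightarrow> ('c eforest, 'k) hopf_data" where
  "tree_hopf q1 q2 =
     \<lparr>hmult = lin_ext (\<lambda>(u, v). basis (u + v)),
      hunit = basis {#},
      hcomult = lin_ext (\<lambda>u. let X = rep_eforest u in
        \<Sum>A\<in>Pow (verts X). pscale (qcoeff q1 q2 A X)
          (basis (eforest_of (subforest X A), eforest_of (subforest X (compl_in X A))))),
      hcounit = (\<lambda>x. Poly_Mapping.lookup x {#}),
      hdeg = (\<lambda>u. \<Sum>t\<in>#u. card (verts (rep_etree t)))\<rparr>"

definition dual_elem :: "'c eforest \<Rightarrow> ('c eforest \<Rightarrow>\<^sub>0 'k::field) \<Rightarrow> 'k" where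
  "dual_elem u = (\<lambda>x. Poly_Mapping.lookup x u)"

abbreviation D_tree :: "'c etree \<Rightarrow> ('c eforest \<Rightarrow>\<^sub>0 'k::field) \<Rightarrow> 'k" where
  "D_tree t \<equiv> dual_elem {#t#}"

definition cut_coeff :: "('c::finite \<Rightarrow> 'k::field) \<Rightarrow> ('c \<Rightarrow> 'k) \<Rightarrow>
    'c etree \<Rightarrow> 'c etree \<Rightarrow> 'c etree \<Rightarrow> 'k" where
  "cut_coeff q1 q2 t s w = (let W = rep_etree w in
     \<Sum>A | A \<subseteq> verts W \<and>
         is_tree (subforest W A) \<and> abs_etree (subforest W A) = s \<and>
         is_tree (subforest W (compl_in W A)) \<and> abs_etree (subforest W (compl_in W A)) = t.
       qcoeff q1 q2 A W)"

text \<open>Bilinear extension, along the basis \<open>D_t\<close> of the primitive elements, of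
  \<open>D_t \<bullet> D_s = \<Sum>w \<Sum>(s \<subset> w, s\<^sup>c = t). q(s,w) D_w\<close>.
  \<^const>\<open>Sum_any\<close> is the sum of a family with finite support.\<close>

definition prim_prod :: "('c::finite \<Rightarrow> 'k::field) \<Rightarrow> ('c \<Rightarrow> 'k) \<Rightarrow>
    (('c eforest \<Rightarrow>\<^sub>0 'k) \<Rightarrow> 'k) \<Rightarrow> (('c eforest \<Rightarrow>\<^sub>0 'k) \<Rightarrow> 'k) \<Rightarrow> (('c eforest \<Rightarrow>\<^sub>0 'k) \<Rightarrow> 'k)"
  where
  "prim_prod q1 q2 \<xi> \<eta> = Sum_any (\<lambda>t. Sum_any (\<lambda>s.
     fscale (\<xi> (basis {#t#}) * \<eta> (basis {#s#}))
       (Sum_any (\<lambda>w. fscale (cut_coeff q1 q2 t s w) (D_tree w)))))"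

section \<open>Pre-Lie algebras\<close>

text \<open>The underlying space \<open>L\<close> is a subspace of an ambient vector space.\<close>

locale pre_lie_algebra = vector_space scale
  for scale :: "'k::field \<Rightarrow> 'v::ab_group_add \<Rightarrow> 'v" +
  fixes L :: "'v set" and prd :: "'v \<Rightarrow> 'v \<Rightarrow> 'v"
  assumes subspace_L: "subspace L"
    and closed: "\<lbrakk>x \<in> L; y \<in> L\<rbrakk> \<Longrightarrow> prd x y \<in> L"
    and add_left: "\<lbrakk>x \<in> L; y \<in> L; z \<in> L\<rbrakk> \<Longrightarrow> prd (x + y) z = prd x z + prd y z"
    and add_right: "\<lbrakk>x \<in> L; y \<in> L; z \<in> L\<rbrakk> \<Longrightarrow> prd x (y + z) = prd x y + prd x z"
    and scale_left: "\<lbrakk>x \<in> L; y \<in> L\<rbrakk> \<Longrightarrow> prd (scale c x) y = scale c (prd x y)"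
    and scale_right: "\<lbrakk>x \<in> L; y \<in> L\<rbrakk> \<Longrightarrow> prd x (scale c y) = scale c (prd x y)"
    and pre_lie: "\<lbrakk>x \<in> L; y \<in> L; z \<in> L\<rbrakk> \<Longrightarrow>
      prd (prd x y) z - prd x (prd y z) = prd (prd x z) y - prd x (prd z y)"

definition pre_lie_hom ::
    "('k \<Rightarrow> 'v \<Rightarrow> 'v) \<Rightarrow> 'v set \<Rightarrow> ('v \<Rightarrow> 'v \<Rightarrow> 'v) \<Rightarrow>
     ('k \<Rightarrow> 'w \<Rightarrow> 'w) \<Rightarrow> 'w set \<Rightarrow> ('w \<Rightarrow> 'w \<Rightarrow> 'w) \<Rightarrow> ('v::plus \<Rightarrow> 'w::plus) \<Rightarrow> bool"
  where
  "pre_lie_hom sc L prd sc' L' prd' \<phi> \<longleftrightarrow> \<phi> ` L \<subseteq> L' \<and>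
     (\<forall>x\<in>L. \<forall>y\<in>L. \<phi> (x + y) = \<phi> x + \<phi> y) \<and>
     (\<forall>c. \<forall>x\<in>L. \<phi> (sc c x) = sc' c (\<phi> x)) \<and>
     (\<forall>x\<in>L. \<forall>y\<in>L. \<phi> (prd x y) = prd' (\<phi> x) (\<phi> y))"

text \<open>The free pre-Lie algebra \<open>L\<^sub>n\<close> is \<open>'c vtree \<Rightarrow>\<^sub>0 'k\<close> with the product \<open>free_prod\<close>.
  In \<open>graft T v S\<close> the vertices of \<open>T\<close> are doubled and those of \<open>S\<close> are sent to odd
  numbers, to make them disjoint.\<close>

definition graft :: "'c vpos \<Rightarrow> nat \<Rightarrow> 'c vpos \<Rightarrow> 'c vpos" where
  "graft T v S =
     \<lparr>verts = (\<lambda>x. 2 * x) ` verts T \<union> (\<lambda>y. 2 * y + 1) ` verts S,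
      le = {(2 * x, 2 * x') | x x'. (x, x') \<in> le T} \<union>
           {(2 * y + 1, 2 * y' + 1) | y y'. (y, y') \<in> le S} \<union>
           {(2 * x, 2 * y + 1) | x y. (x, v) \<in> le T \<and> y \<in> verts S},
      vcol = (\<lambda>z. if even z then vcol T (z div 2) else vcol S (z div 2))\<rparr>"

definition free_prod ::
    "('c vtree \<Rightarrow>\<^sub>0 'k::field) \<Rightarrow> ('c vtree \<Rightarrow>\<^sub>0 'k) \<Rightarrow> ('c vtree \<Rightarrow>\<^sub>0 'k)" where
  "free_prod f g = lin_ext (\<lambda>t. lin_ext (\<lambda>s.
     \<Sum>v\<in>verts (rep_vtree t). basis (abs_vtree (graft (rep_vtree t) v (rep_vtree s)))) g) f"

definition recolour_root :: "'c \<Rightarrow> 'c vtree \<Rightarrow> 'c vtree" where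
  "recolour_root i t = (let X = rep_vtree t in
     abs_vtree (X\<lparr>vcol := (vcol X)(root X := i)\<rparr>))"

end

theory Submission
  imports Defs "HOL-Library.FuncSet"
begin

text \<open>
  As every \<open>q2 j\<close> vanishes, \<open>q(s,w)\<close> is nonzero only if \<open>s\<close> is the part of \<open>w\<close> above a vertex \<open>r\<close>
  that is not the root and all edges below \<open>r\<close> have colours in \<open>p\<close>; then it is \<open>1\<close>.  The
  coefficient of a product at \<open>w\<close> is thus a sum over such cuts \<open>r\<close> of \<open>w\<close>, and in the associator
  only pairs of incomparable cuts survive, which gives an expression symmetric in the last two
  factors.

  For \<open>p = UNIV\<close>, the embedding moves the colour of an edge to its upper vertex, sums over all
  colours of the root and divides by the order of the automorphism group.  It is multiplicative
  because a pair of a vertex \<open>v\<close> of \<open>X\<close> and an isomorphism from the graft of \<open>Z\<close> at \<open>v\<close> onto \<open>Y\<close>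
  is the same as a cut of \<open>Y\<close> with isomorphisms of \<open>X\<close> and \<open>Z\<close> onto its two parts.
\<close>

section \<open>Finite forests\<close>

text \<open>The two products count different things: grafting counts vertices of the first factor,
  cutting counts vertices of the result. The number of isomorphisms between two isomorphic trees is
  the order of their automorphism group, so the two counts differ by the ratio of such orders for
  the result and for the two factors. This is where the denominators come from, and characteristic
  zero makes them invertible.

  The sum over root colours has a similar origin: a cut destroys the edge that carried the upper
  part. With colours on vertices its colour survives as the root colour of that part, with colours
  on edges it is lost. Automorphisms fix the root, so the denominator is the same for all root
  colours.

  In the pre-Lie identity the obstacle is the choice of representatives: an iterated product cuts a
  chosen representative of a part, not the part itself. Invariance of sums over cuts under
  isomorphism moves everything back into one poset, where an iterated cut is a pair of
  vertices.\<close>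

definition up :: "'z poset_scheme \<Rightarrow> nat \<Rightarrow> nat set" where
  "up X r = {x. (r, x) \<in> le X}"

definition lower :: "'z poset_scheme \<Rightarrow> nat \<Rightarrow> nat set" where
  "lower X r = verts X - up X r"

context
  fixes X :: "'z poset_scheme"
  assumes forest: "is_forest X"
begin

lemma finite_verts: "finite (verts X)"
  using forest by (simp add: is_forest_def)

lemma le_verts: "(x, y) \<in> le X \<Longrightarrow> x \<in> verts X \<and> y \<in> verts X"
  using forest unfolding is_forest_def partial_order_on_def preorder_on_def by blast

lemma le_refl: "x \<in> verts X \<Longrightarrow> (x, x) \<in> le X"
  using forest unfolding is_forest_def partial_order_on_def preorder_on_def refl_on_def by blast

lemma le_trans: "(x, y) \<in> le X \<Longrightarrow> (y, z) \<in> le X \<Longrightarrow> (x, z) \<in> le X"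
  using forest unfolding is_forest_def partial_order_on_def preorder_on_def trans_def by blast

lemma le_antisym: "(x, y) \<in> le X \<Longrightarrow> (y, x) \<in> le X \<Longrightarrow> x = y"
  using forest unfolding is_forest_def partial_order_on_def antisym_def by blast

lemma le_chain: "(y, x) \<in> le X \<Longrightarrow> (z, x) \<in> le X \<Longrightarrow> (y, z) \<in> le X \<or> (z, y) \<in> le X"
  using forest le_verts le_refl unfolding is_forest_def by metis

lemma finite_le: "finite (le X)"
  by (rule finite_subset[of _ "verts X \<times> verts X"]) (use le_verts finite_verts in auto)

lemma up_subset: "up X r \<subseteq> verts X"
  using le_verts by (auto simp: up_def)

lemma finite_up: "finite (up X r)"
  using up_subset finite_verts finite_subset by blast

text \<open>Among the vertices strictly above \<open>x\<close> and at most \<open>y\<close>, take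
  one with the fewest vertices below it: anything strictly between it and \<open>x\<close> would
  have fewer still.\<close>

lemma edge_above:
  assumes "(x, y) \<in> le X" "x \<noteq> y"
  obtains b where "edge X x b" "(b, y) \<in> le X"
proof -
  let ?P = "\<lambda>b. (x, b) \<in> le X \<and> x \<noteq> b \<and> (b, y) \<in> le X"
  let ?m = "\<lambda>b. card {z. (z, b) \<in> le X}"
  have fin: "finite {z. (z, b) \<in> le X}" for b
    by (rule finite_subset[OF _ finite_verts]) (use le_verts in auto)
  have "?P y" using assms le_refl le_verts by blast
  then obtain b where b: "?P b" and min: "\<And>c. ?P c \<Longrightarrow> ?m b \<le> ?m c"
    using ex_has_least_nat[of ?P y ?m] by blast
  have "edge X x b"
  proof (rule ccontr)
    assume "\<not> edge X x b"
    then obtain c where c: "(x, c) \<in> le X" "x \<noteq> c" "(c, b) \<in> le X" "c \<noteq> b"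
      using b by (auto simp: edge_def)
    have "{z. (z, c) \<in> le X} \<subset> {z. (z, b) \<in> le X}"
      using c le_trans le_antisym le_refl le_verts by blast
    then have "?m c < ?m b" using fin psubset_card_mono by blast
    moreover have "?P c" using c b le_trans by blast
    ultimately show False using min by fastforce
  qed
  then show thesis using b that by blast
qed

lemma edge_below:
  assumes "(x, y) \<in> le X" "x \<noteq> y"
  obtains a where "edge X a y" "(x, a) \<in> le X"
proof -
  let ?P = "\<lambda>b. (b, y) \<in> le X \<and> b \<noteq> y \<and> (x, b) \<in> le X"
  let ?m = "\<lambda>b. card {z. (b, z) \<in> le X}"
  have fin: "finite {z. (b, z) \<in> le X}" for b
    by (rule finite_subset[OF _ finite_verts]) (use le_verts in auto)
  have "?P x" using assms le_refl le_verts by blast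
  then obtain b where b: "?P b" and min: "\<And>c. ?P c \<Longrightarrow> ?m b \<le> ?m c"
    using ex_has_least_nat[of ?P x ?m] by blast
  have "edge X b y"
  proof (rule ccontr)
    assume "\<not> edge X b y"
    then obtain c where c: "(b, c) \<in> le X" "b \<noteq> c" "(c, y) \<in> le X" "c \<noteq> y"
      using b by (auto simp: edge_def)
    have "{z. (c, z) \<in> le X} \<subset> {z. (b, z) \<in> le X}"
      using c le_trans le_antisym le_refl le_verts by blast
    then have "?m c < ?m b" using fin psubset_card_mono by blast
    moreover have "?P c" using c b le_trans by blast
    ultimately show False using min by fastforce
  qed
  then show thesis using b that by blast
qed

text \<open>The vertices below \<open>y\<close> form a chain and nothing lies strictly between
  \<open>a\<close> and \<open>y\<close>, so \<open>a\<close> is the greatest of those strictly below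
  \<open>y\<close>, its parent.\<close>

lemma edge_lower_unique: "edge X a y \<Longrightarrow> (x, y) \<in> le X \<Longrightarrow> x \<noteq> y \<Longrightarrow> (x, a) \<in> le X"
  using le_chain[of a y x] le_refl[of a] le_verts unfolding edge_def by metis

end

lemma tree_forest: "is_tree X \<Longrightarrow> is_forest X"
  by (simp add: is_tree_def)

lemma root_eqI:
  assumes "is_forest X" "r \<in> verts X" "\<And>x. x \<in> verts X \<Longrightarrow> (r, x) \<in> le X"
  shows "root X = r"
  unfolding root_def using assms le_antisym[OF assms(1)] by (intro the_equality) blast+

lemma root_verts: "is_tree X \<Longrightarrow> root X \<in> verts X"
  and root_le: "is_tree X \<Longrightarrow> x \<in> verts X \<Longrightarrow> (root X, x) \<in> le X"
  using root_eqI[OF tree_forest] unfolding is_tree_def by metis+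

lemma is_forest_restrict:
  fixes X :: "'z poset_scheme" and Y :: "'y poset_scheme"
  assumes "is_forest X" "le Y = Restr (le X) (verts Y)" "verts Y \<subseteq> verts X"
  shows "is_forest Y"
proof -
  note f = finite_verts[OF assms(1)] le_refl[OF assms(1)] le_trans[OF assms(1)]
    le_antisym[OF assms(1)] le_chain[OF assms(1)]
  have "finite (verts Y)" using f(1) assms(3) finite_subset by blast
  moreover have "partial_order_on (verts Y) (le Y)"
    unfolding partial_order_on_def preorder_on_def refl_on_def trans_def antisym_def assms(2)
    using f(2-4) assms(3) by blast
  moreover have "(y, z) \<in> le Y \<or> (z, y) \<in> le Y" if "(y, x) \<in> le Y" "(z, x) \<in> le Y" for x y z
    using that f(5) unfolding assms(2) by blast
  ultimately show ?thesis unfolding is_forest_def by blast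
qed

lemma is_tree_upper:
  fixes X :: "'z poset_scheme" and Y :: "'y poset_scheme"
  assumes "is_forest X" "r \<in> verts X" "verts Y = up X r" "le Y = Restr (le X) (up X r)"
  shows "is_tree Y" "root Y = r"
proof -
  have f: "is_forest Y"
    using is_forest_restrict[OF assms(1), of Y] assms(3,4) up_subset[OF assms(1)] by auto
  have r: "r \<in> verts Y" "\<And>x. x \<in> verts Y \<Longrightarrow> (r, x) \<in> le Y"
    using assms le_refl[OF assms(1)] by (auto simp: up_def)
  show "is_tree Y" using f r by (auto simp: is_tree_def)
  show "root Y = r" using root_eqI f r by blast
qed

lemma is_tree_lower:
  fixes X :: "'z poset_scheme" and Y :: "'y poset_scheme"
  assumes "is_tree X" "r \<in> verts X" "r \<noteq> root X" "verts Y = lower X r"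
    "le Y = Restr (le X) (lower X r)"
  shows "is_tree Y" "root Y = root X"
proof -
  have X: "is_forest X" using assms(1) by (rule tree_forest)
  have f: "is_forest Y"
    using is_forest_restrict[OF X, of Y] assms(4,5) by (auto simp: lower_def)
  have "root X \<in> verts Y"
    using assms root_verts[OF assms(1)] root_le[OF assms(1,2)] le_antisym[OF X]
    by (auto simp: lower_def up_def)
  moreover have "\<And>x. x \<in> verts Y \<Longrightarrow> (root X, x) \<in> le Y"
    using calculation root_le[OF assms(1)] assms(4,5) by (auto simp: lower_def)
  ultimately show "is_tree Y" "root Y = root X"
    using f root_eqI by (auto simp: is_tree_def)
qed

lemma is_tree_rep_etree: "is_tree (rep_etree t)"
  using Quotient_rep_reflp[OF Quotient_etree] by blast

lemma abs_etree_eq_iff: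
  "is_tree X \<Longrightarrow> is_tree Y \<Longrightarrow> abs_etree X = abs_etree Y \<longleftrightarrow> epos_iso X Y"
proof -
  assume t: "is_tree X" "is_tree Y"
  have r: "epos_iso Z Z" for Z :: "'a epos"
    unfolding epos_iso_def by (rule exI[of _ id]) (simp add: poset_iso_id)
  show ?thesis
    using Quotient_rel[OF Quotient_etree, of X Y] t r by blast
qed

lemma epos_iso_rep_abs: "is_tree X \<Longrightarrow> epos_iso X (rep_etree (abs_etree X))"
  using abs_etree_eq_iff[of X "rep_etree (abs_etree X)"] is_tree_rep_etree
    Quotient_abs_rep[OF Quotient_etree] by metis

text \<open>Both sides of a cut are of this kind. A convex subset contains all vertices between two
  of its own, so its edges are exactly the edges of \<open>X\<close> with both ends in it.\<close>

definition order_convex :: "'z poset_scheme \<Rightarrow> nat set \<Rightarrow> bool" where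
  "order_convex X A \<longleftrightarrow> A \<subseteq> verts X \<and>
     (\<forall>x\<in>A. \<forall>z\<in>A. \<forall>y. (x, y) \<in> le X \<longrightarrow> (y, z) \<in> le X \<longrightarrow> y \<in> A)"

lemma edge_restrict:
  fixes X :: "'z poset_scheme" and Y :: "'y poset_scheme"
  assumes "order_convex X A" "le Y = Restr (le X) A"
  shows "edge Y v w \<longleftrightarrow> v \<in> A \<and> w \<in> A \<and> edge X v w"
proof -
  have "x \<in> A" if "(v, x) \<in> le X" "(x, w) \<in> le X" "v \<in> A" "w \<in> A" for x
    using assms(1) that unfolding order_convex_def by blast
  then show ?thesis unfolding edge_def assms(2) by blast
qed

lemma order_convex_up: "is_forest X \<Longrightarrow> order_convex X (up X r)"
  unfolding order_convex_def
  using up_subset[of X r] by (auto simp: up_def intro: le_trans)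

lemma order_convex_lower: "is_forest X \<Longrightarrow> order_convex X (lower X r)"
  unfolding order_convex_def lower_def by (auto simp: up_def dest: le_verts intro: le_trans)

text \<open>A variant of \<open>subforest\<close> that leaves the colour function alone. Restricting
  twice is then literally the same as restricting once, which makes iterated cuts easy to
  compare.\<close>

definition esub :: "'c epos \<Rightarrow> nat set \<Rightarrow> 'c epos" where
  "esub X A = \<lparr>verts = A, le = Restr (le X) A, ecol = ecol X\<rparr>"

lemma esub_simps [simp]:
  "verts (esub X A) = A" "le (esub X A) = Restr (le X) A" "ecol (esub X A) = ecol X"
  by (simp_all add: esub_def)

lemma esub_esub: "B \<subseteq> A \<Longrightarrow> esub (esub X A) B = esub X B"
  by (auto simp: esub_def)

lemma is_tree_cong:
  fixes X :: "'z poset_scheme" and Y :: "'y poset_scheme"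
  shows "verts X = verts Y \<Longrightarrow> le X = le Y \<Longrightarrow> is_tree X \<longleftrightarrow> is_tree Y"
  unfolding is_tree_def is_forest_def by simp

lemma root_cong:
  fixes X :: "'z poset_scheme" and Y :: "'y poset_scheme"
  shows "verts X = verts Y \<Longrightarrow> le X = le Y \<Longrightarrow> root X = root Y"
  unfolding root_def by simp

lemma is_tree_subforest: "is_tree (subforest X A) \<longleftrightarrow> is_tree (esub X A)"
  by (rule is_tree_cong) (simp_all add: subforest_def)

text \<open>An edge of a convex subset is an edge of \<open>X\<close>, so the upward path that
  determines its colour consists of this one edge.\<close>

lemma abs_etree_subforest:
  assumes X: "is_forest X" and A: "order_convex X A" and tree: "is_tree (esub X A)"
  shows "abs_etree (subforest X A) = abs_etree (esub X A)"
proof -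
  have "ecol (subforest X A) v w = ecol X v w" if "edge (subforest X A) v w" for v w
  proof -
    have e: "edge X v w"
      using that edge_restrict[OF A, of "subforest X A"] by (simp add: subforest_def)
    then have "(w, w) \<in> le X"
      using le_refl[OF X, of w] le_verts[OF X, of v w] by (simp add: edge_def)
    then have "(THE u. edge X v u \<and> (u, w) \<in> le X) = w"
      using e unfolding edge_def by blast
    then show ?thesis by (simp add: subforest_def)
  qed
  then have "epos_iso (subforest X A) (esub X A)"
    unfolding epos_iso_def
    by (intro exI[of _ id]) (auto simp: poset_iso_def subforest_def)
  then show ?thesis using tree is_tree_subforest abs_etree_eq_iff by blast
qed

section \<open>The two parts of a tree cut at a vertex\<close>

definition elower :: "'c epos \<Rightarrow> nat \<Rightarrow> 'c epos" where
  "elower X r = esub X (lower X r)"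

definition eupper :: "'c epos \<Rightarrow> nat \<Rightarrow> 'c epos" where
  "eupper X r = esub X (up X r)"

lemma is_tree_eupper: "is_forest X \<Longrightarrow> r \<in> verts X \<Longrightarrow> is_tree (eupper X r)"
  and root_eupper: "is_forest X \<Longrightarrow> r \<in> verts X \<Longrightarrow> root (eupper X r) = r"
  using is_tree_upper[of X r "eupper X r"] by (simp_all add: eupper_def)

lemma is_tree_elower: "is_tree X \<Longrightarrow> r \<in> verts X \<Longrightarrow> r \<noteq> root X \<Longrightarrow> is_tree (elower X r)"
  and root_elower:
    "is_tree X \<Longrightarrow> r \<in> verts X \<Longrightarrow> r \<noteq> root X \<Longrightarrow> root (elower X r) = root X"
  using is_tree_lower[of X r "elower X r"] by (simp_all add: elower_def)

lemma edge_eupper: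
  assumes X: "is_forest X"
  shows "edge (eupper X r) a b \<longleftrightarrow> (r, a) \<in> le X \<and> edge X a b"
proof -
  have "edge (eupper X r) a b \<longleftrightarrow> a \<in> up X r \<and> b \<in> up X r \<and> edge X a b"
    by (rule edge_restrict[OF order_convex_up[OF X]]) (simp add: eupper_def)
  moreover have "edge X a b \<Longrightarrow> (r, a) \<in> le X \<Longrightarrow> (r, b) \<in> le X"
    using le_trans[OF X, of r a b] by (simp add: edge_def)
  ultimately show ?thesis unfolding up_def by blast
qed

lemma edge_elower:
  assumes X: "is_forest X"
  shows "edge (elower X r) a b \<longleftrightarrow> (r, b) \<notin> le X \<and> edge X a b"
proof -
  have "edge (elower X r) a b \<longleftrightarrow> a \<in> lower X r \<and> b \<in> lower X r \<and> edge X a b"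
    by (rule edge_restrict[OF order_convex_lower[OF X]]) (simp add: elower_def)
  moreover have "edge X a b \<Longrightarrow> (r, a) \<in> le X \<Longrightarrow> (r, b) \<in> le X"
    using le_trans[OF X, of r a b] by (simp add: edge_def)
  moreover have "edge X a b \<Longrightarrow> a \<in> verts X \<and> b \<in> verts X"
    using le_verts[OF X, of a b] by (simp add: edge_def)
  ultimately show ?thesis unfolding lower_def up_def by blast
qed

section \<open>Admissible cuts\<close>

definition admissible :: "'c set \<Rightarrow> 'c epos \<Rightarrow> nat set" where
  "admissible p X = {r \<in> verts X. r \<noteq> root X \<and>
     (\<forall>a b. edge X a b \<longrightarrow> (b, r) \<in> le X \<longrightarrow> ecol X a b \<in> p)}"

lemma finite_admissible: "is_tree X \<Longrightarrow> finite (admissible p X)"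
  unfolding admissible_def by (simp add: finite_verts tree_forest)

lemma iso_root:
  fixes X :: "'y poset_scheme" and Y :: "'z poset_scheme"
  assumes "poset_iso f X Y" "is_tree X" "is_tree Y"
  shows "f (root X) = root Y"
proof -
  have b: "bij_betw f (verts X) (verts Y)" using assms by (simp add: poset_iso_def)
  have "(f (root X), y) \<in> le Y" if y: "y \<in> verts Y" for y
  proof -
    obtain x where x: "x \<in> verts X" "y = f x"
      using b y unfolding bij_betw_def by blast
    then show ?thesis
      using assms(1) root_verts[OF assms(2)] root_le[OF assms(2) x(1)] by (simp add: poset_iso_def)
  qed
  moreover have "f (root X) \<in> verts Y"
    using b root_verts[OF assms(2)] by (rule bij_betw_apply)
  ultimately show ?thesis using root_eqI[OF tree_forest] assms(3) by metis
qed

lemma iso_up: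
  fixes X :: "'y poset_scheme" and Y :: "'z poset_scheme"
  assumes "poset_iso f X Y" "is_tree X" "is_tree Y" "r \<in> verts X"
  shows "f ` up X r = up Y (f r)" "f ` lower X r = lower Y (f r)"
proof -
  note X = tree_forest[OF assms(2)] and Y = tree_forest[OF assms(3)]
  have b: "f ` verts X = verts Y" "inj_on f (verts X)"
    and o: "\<And>x y. x \<in> verts X \<Longrightarrow> y \<in> verts X \<Longrightarrow> (x, y) \<in> le X \<longleftrightarrow> (f x, f y) \<in> le Y"
    using assms(1) by (auto simp: poset_iso_def bij_betw_def)
  show u: "f ` up X r = up Y (f r)"
  proof
    show "f ` up X r \<subseteq> up Y (f r)"
      using o[OF assms(4)] le_verts[OF X] unfolding up_def by blast
    show "up Y (f r) \<subseteq> f ` up X r"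
    proof
      fix y assume y: "y \<in> up Y (f r)"
      then have "y \<in> verts Y" using le_verts[OF Y] by (simp add: up_def)
      then obtain x where "x \<in> verts X" "y = f x" using b(1) by blast
      then show "y \<in> f ` up X r" using o[OF assms(4)] y by (simp add: up_def)
    qed
  qed
  show "f ` lower X r = lower Y (f r)"
    unfolding lower_def u[symmetric] b(1)[symmetric]
    using inj_on_image_set_diff[OF b(2)] up_subset[OF X] by blast
qed

lemma epos_iso_esub:
  assumes f: "poset_iso f X Y" and c: "\<And>v w. edge X v w \<Longrightarrow> ecol X v w = ecol Y (f v) (f w)"
    and A: "order_convex X A"
  shows "epos_iso (esub X A) (esub Y (f ` A))"
  unfolding epos_iso_def
proof (intro exI conjI allI impI)
  have "A \<subseteq> verts X" using A by (simp add: order_convex_def)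
  then show "poset_iso f (esub X A) (esub Y (f ` A))"
    using f by (auto simp: poset_iso_def subset_iff bij_betw_def inj_on_def)
  show "ecol (esub X A) v w = ecol (esub Y (f ` A)) (f v) (f w)" if "edge (esub X A) v w" for v w
    using that edge_restrict[OF A, of "esub X A"] c by simp
qed

lemma admissible_iso:
  assumes t: "is_tree X" "is_tree Y" and f: "poset_iso f X Y"
    and c: "\<And>v w. edge X v w \<Longrightarrow> ecol X v w = ecol Y (f v) (f w)"
  shows "bij_betw f (admissible p X) (admissible p Y)"
proof -
  note X = tree_forest[OF t(1)] and Y = tree_forest[OF t(2)]
  have b: "f ` verts X = verts Y" "inj_on f (verts X)"
    and o: "\<And>x y. x \<in> verts X \<Longrightarrow> y \<in> verts X \<Longrightarrow> (x, y) \<in> le X \<longleftrightarrow> (f x, f y) \<in> le Y"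
    using f by (auto simp: poset_iso_def bij_betw_def)
  let ?g = "inv_into (verts X) f"
  have g: "poset_iso ?g Y X" using f by (rule poset_iso_inv)
  have "f r \<in> admissible p Y \<longleftrightarrow> r \<in> admissible p X" if r: "r \<in> verts X" for r
  proof -
    have 1: "f r \<noteq> root Y \<longleftrightarrow> r \<noteq> root X"
      using iso_root[OF f t] root_verts[OF t(1)] b(2) r by (metis inj_onD)
    have "(\<forall>a b. edge Y a b \<longrightarrow> (b, f r) \<in> le Y \<longrightarrow> ecol Y a b \<in> p) \<longleftrightarrow>
      (\<forall>a b. edge X a b \<longrightarrow> (b, r) \<in> le X \<longrightarrow> ecol X a b \<in> p)" (is "?L = ?R")
    proof
      assume L: ?L
      show ?R
        using L poset_iso_edge[OF f t] c edge_verts[OF t(1)] o r by metis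
    next
      assume R: ?R
      show ?L
      proof (intro allI impI)
        fix u v assume e: "edge Y u v" and l: "(v, f r) \<in> le Y"
        have e': "edge X (?g u) (?g v)" by (rule poset_iso_edge[OF g t(2,1) e])
        have uv: "u \<in> verts Y" "v \<in> verts Y" using edge_verts[OF t(2) e] by auto
        then have fg: "f (?g u) = u" "f (?g v) = v" "?g v \<in> verts X"
          using b by (auto simp: f_inv_into_f inv_into_into)
        then have "(?g v, r) \<in> le X" using o r l by metis
        then have "ecol X (?g u) (?g v) \<in> p" using R e' by blast
        then show "ecol Y u v \<in> p" using c[OF e'] fg by simp
      qed
    qed
    then show ?thesis using 1 r b by (auto simp: admissible_def)
  qed
  moreover have "admissible p X \<subseteq> verts X" "admissible p Y \<subseteq> f ` verts X" using b by (auto simp: admissible_def)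
  ultimately show ?thesis
    unfolding bij_betw_def using b(2) by (auto intro: inj_on_subset)
qed

text \<open>For \<open>F t s = x t * y s\<close> this is the coordinate, at the tree
  \<open>X\<close>, of the product of the primitive elements with coordinates \<open>x\<close> and
  \<open>y\<close>. An arbitrary \<open>F\<close> covers nested products as well.\<close>

definition cut_sum ::
  "'c set \<Rightarrow> ('c etree \<Rightarrow> 'c etree \<Rightarrow> 'a::comm_monoid_add) \<Rightarrow> 'c epos \<Rightarrow> 'a" where
  "cut_sum p F X = (\<Sum>r\<in>admissible p X. F (abs_etree (elower X r)) (abs_etree (eupper X r)))"

lemma cut_sum_iso:
  assumes t: "is_tree X" "is_tree Y" and "epos_iso X Y"
  shows "cut_sum p F X = cut_sum p F Y"
proof -
  obtain f where f: "poset_iso f X Y"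
    and c: "\<And>v w. edge X v w \<Longrightarrow> ecol X v w = ecol Y (f v) (f w)"
    using assms(3) by (auto simp: epos_iso_def)
  note X = tree_forest[OF t(1)]
  have 1: "abs_etree (elower X r) = abs_etree (elower Y (f r))"
    "abs_etree (eupper X r) = abs_etree (eupper Y (f r))" if r: "r \<in> admissible p X" for r
  proof -
    have rX: "r \<in> verts X" "r \<noteq> root X" using r by (auto simp: admissible_def)
    have rY: "f r \<in> verts Y" "f r \<noteq> root Y"
      using admissible_iso[OF t f c, of p] r by (auto simp: admissible_def bij_betw_def)
    show "abs_etree (elower X r) = abs_etree (elower Y (f r))"
      using epos_iso_esub[OF f c order_convex_lower[OF X], of r] iso_up(2)[OF f t rX(1)]
        abs_etree_eq_iff is_tree_elower t rX rY unfolding elower_def by metis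
    show "abs_etree (eupper X r) = abs_etree (eupper Y (f r))"
      using epos_iso_esub[OF f c order_convex_up[OF X], of r] iso_up(1)[OF f t rX(1)]
        abs_etree_eq_iff is_tree_eupper[OF tree_forest] t rX rY unfolding eupper_def by metis
  qed
  show ?thesis
    unfolding cut_sum_def
    by (subst sum.reindex_bij_betw[OF admissible_iso[OF t f c], symmetric]) (simp_all add: 1)
qed

text \<open>Used for nested products: the inner sum is over cuts of the representative chosen for a
  part of a tree, and this replaces it by the part as a subset of the original vertices.\<close>

lemma cut_sum_rep:
  "is_tree X \<Longrightarrow> cut_sum p F (rep_etree (abs_etree X)) = cut_sum p F X"
  by (rule cut_sum_iso[symmetric]) (simp_all add: is_tree_rep_etree epos_iso_rep_abs)

definition esize :: "'c etree \<Rightarrow> nat" where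
  "esize t = card (verts (rep_etree t))"

lemma esize_abs: "is_tree X \<Longrightarrow> esize (abs_etree X) = card (verts X)"
  using epos_iso_rep_abs[of X]
  unfolding esize_def epos_iso_def poset_iso_def by (auto dest: bij_betw_same_card)

lemma card_up_lower: "is_forest X \<Longrightarrow> card (lower X r) + card (up X r) = card (verts X)"
  unfolding lower_def
  by (simp add: card_Diff_subset card_mono finite_up finite_verts up_subset)

lemma admissible_esize:
  assumes "is_tree X" "r \<in> admissible p X"
  shows "esize (abs_etree (elower X r)) + esize (abs_etree (eupper X r)) = card (verts X)"
proof -
  have r: "r \<in> verts X" "r \<noteq> root X" using assms(2) by (auto simp: admissible_def)
  show ?thesis
    using esize_abs[OF is_tree_elower[OF assms(1) r]]
      esize_abs[OF is_tree_eupper[OF tree_forest[OF assms(1)] r(1)]]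
      card_up_lower[OF tree_forest[OF assms(1)]] by (simp add: elower_def eupper_def)
qed

text \<open>Both \<open>b\<close> and \<open>r\<close> lie below \<open>v\<close>, hence are
  comparable. If \<open>r\<close> were strictly below \<open>b\<close>, then \<open>a\<close> and
  \<open>r\<close> would be comparable too, and \<open>r\<close> would lie strictly inside the edge.
  So on the path from \<open>v\<close> to the root, the edges that start outside the part above
  \<open>r\<close> are edges of the path from \<open>r\<close>.\<close>

lemma edge_path_up:
  assumes X: "is_forest X" and e: "edge X a b" "(b, v) \<in> le X" and r: "(r, v) \<in> le X" "(r, a) \<notin> le X"
  shows "(b, r) \<in> le X"
proof (rule ccontr)
  assume n: "(b, r) \<notin> le X"
  then have rb: "(r, b) \<in> le X" "r \<noteq> b"
    using le_chain[OF X e(2) r(1)] le_refl[OF X] le_verts[OF X e(2)] by blast+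
  then have "(a, r) \<in> le X" "a \<noteq> r"
    using le_chain[OF X, of a b r] e(1) r(2) le_refl[OF X, of a] le_verts[OF X, of a b]
    unfolding edge_def by blast+
  then show False using e(1) rb unfolding edge_def by blast
qed

text \<open>Each power is \<open>0\<close> or \<open>1\<close> because \<open>0 ^ 0 = 1\<close>. A
  factor with \<open>q2\<close> is \<open>1\<close> only if its exponent is \<open>0\<close>;
  together these say that no vertex of \<open>A\<close> lies below one outside \<open>A\<close>. A
  factor with \<open>q1\<close> is \<open>0\<close> only if a colour outside \<open>p\<close>
  occurs.\<close>

lemma qcoeff_eq:
  fixes q1 q2 :: "'c::finite \<Rightarrow> 'k::field"
  assumes q1: "\<And>j. q1 j = (if j \<in> p then 1 else 0)" and q2: "\<And>j. q2 j = 0"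
    and X: "is_tree X" and A: "A \<subseteq> verts X"
  shows "qcoeff q1 q2 A X =
    (if (\<forall>a b. a \<in> A \<longrightarrow> (a, b) \<in> le X \<longrightarrow> b \<in> A) \<and>
        (\<forall>v\<in>A. \<forall>a b. edge X a b \<longrightarrow> (b, v) \<in> le X \<longrightarrow> a \<notin> A \<longrightarrow> ecol X a b \<in> p)
     then 1 else 0)"
proof -
  note F = tree_forest[OF X]
  have finP: "finite {(a, b). edge X a b \<and> (b, v) \<in> le X \<and> ecol X a b = j \<and> a \<in> B}" for v j B
    by (rule finite_subset[OF _ finite_le[OF F]]) (auto simp: edge_def)
  have AV: "a \<in> compl_in X B \<longleftrightarrow> a \<in> verts X \<and> a \<notin> B" for a B by (simp add: compl_in_def)
  have p1: "q1 j ^ pnum j v A X = (if j \<in> p \<or> (\<forall>a b. edge X a b \<longrightarrow> (b, v) \<in> le X \<longrightarrow> a \<notin> A \<longrightarrow> ecol X a b \<noteq> j) then 1 else 0)" for j v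
  proof -
    have "pnum j v A X = 0 \<longleftrightarrow> (\<forall>a b. edge X a b \<longrightarrow> (b, v) \<in> le X \<longrightarrow> a \<notin> A \<longrightarrow> ecol X a b \<noteq> j)"
      unfolding pnum_def card_eq_0_iff using finP edge_verts[OF X] AV by blast
    then show ?thesis using q1 by (auto simp: power_0_left)
  qed
  have p2: "q2 j ^ pnum j v (compl_in X A) X = (if (\<forall>a b. edge X a b \<longrightarrow> (b, v) \<in> le X \<longrightarrow> a \<in> A \<longrightarrow> ecol X a b \<noteq> j) then 1 else 0)" for j v
  proof -
    have "pnum j v (compl_in X A) X = 0 \<longleftrightarrow> (\<forall>a b. edge X a b \<longrightarrow> (b, v) \<in> le X \<longrightarrow> a \<in> A \<longrightarrow> ecol X a b \<noteq> j)"
      unfolding pnum_def AV card_eq_0_iff using finP[of v j "compl_in X (compl_in X A)"]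
        edge_verts[OF X] by (auto simp: AV)
    then show ?thesis using q2 by (auto simp: power_0_left)
  qed
  have finA: "finite A" using A finite_verts[OF F] finite_subset by blast
  have finB: "finite (compl_in X A)" using finite_verts[OF F] by (simp add: compl_in_def)
  have prod01: "(\<Prod>x\<in>S. if Q x then 1 else 0 :: 'k) = (if \<forall>x\<in>S. Q x then 1 else 0)"
    if "finite S" for S :: "'z set" and Q
    using that by induction auto
  have mult01: "(if Q then 1 else 0) * (if R then 1 else 0) = (if Q \<and> R then 1 else 0 :: 'k)" for Q R
    by simp
  have "qcoeff q1 q2 A X = (\<Prod>j\<in>UNIV. (if (\<forall>v\<in>A. j \<in> p \<or> (\<forall>a b. edge X a b \<longrightarrow> (b, v) \<in> le X \<longrightarrow> a \<notin> A \<longrightarrow> ecol X a b \<noteq> j)) \<and>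
      (\<forall>v\<in>compl_in X A. \<forall>a b. edge X a b \<longrightarrow> (b, v) \<in> le X \<longrightarrow> a \<in> A \<longrightarrow> ecol X a b \<noteq> j) then 1 else 0))"
    unfolding qcoeff_def p1 p2 prod01[OF finA] prod01[OF finB] mult01 by (rule refl)
  also have "\<dots> = (if (\<forall>j. (\<forall>v\<in>A. j \<in> p \<or> (\<forall>a b. edge X a b \<longrightarrow> (b, v) \<in> le X \<longrightarrow> a \<notin> A \<longrightarrow> ecol X a b \<noteq> j)) \<and>
      (\<forall>v\<in>compl_in X A. \<forall>a b. edge X a b \<longrightarrow> (b, v) \<in> le X \<longrightarrow> a \<in> A \<longrightarrow> ecol X a b \<noteq> j)) then 1 else 0)"
    by (subst prod01) simp_all
  finally have main: "qcoeff q1 q2 A X = \<dots>" .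
  have e1: "(\<forall>j. (\<forall>v\<in>A. j \<in> p \<or> (\<forall>a b. edge X a b \<longrightarrow> (b, v) \<in> le X \<longrightarrow> a \<notin> A \<longrightarrow> ecol X a b \<noteq> j)) \<and>
      (\<forall>v\<in>compl_in X A. \<forall>a b. edge X a b \<longrightarrow> (b, v) \<in> le X \<longrightarrow> a \<in> A \<longrightarrow> ecol X a b \<noteq> j)) \<longleftrightarrow>
      (\<forall>v\<in>A. \<forall>a b. edge X a b \<longrightarrow> (b, v) \<in> le X \<longrightarrow> a \<notin> A \<longrightarrow> ecol X a b \<in> p) \<and>
      (\<forall>v\<in>compl_in X A. \<forall>a b. edge X a b \<longrightarrow> (b, v) \<in> le X \<longrightarrow> a \<notin> A)"
    by blast
  \<comment> \<open>If \<open>A\<close> is not up-closed, some \<open>a\<close> in \<open>A\<close>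
    lies below some \<open>v\<close> outside \<open>A\<close>. The first edge on the path from
    \<open>a\<close> up to \<open>v\<close> has its lower vertex in \<open>A\<close> and makes an
    exponent of \<open>q2\<close> positive.\<close>
  have e2: "(\<forall>v\<in>compl_in X A. \<forall>a b. edge X a b \<longrightarrow> (b, v) \<in> le X \<longrightarrow> a \<notin> A) \<longleftrightarrow>
      (\<forall>a b. a \<in> A \<longrightarrow> (a, b) \<in> le X \<longrightarrow> b \<in> A)" (is "?L = ?R")
  proof
    assume L: ?L
    show ?R
    proof (intro allI impI, rule ccontr)
      fix a v assume a: "a \<in> A" "(a, v) \<in> le X" "v \<notin> A"
      then obtain b where "edge X a b" "(b, v) \<in> le X" using edge_above[OF F, of a v] by blast
      moreover have "v \<in> compl_in X A" using a le_verts[OF F] AV by blast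
      ultimately show False using L a by blast
    qed
  next
    assume ?R
    then show ?L using AV le_trans[OF F] by (meson edge_def)
  qed
  show ?thesis unfolding main e1 e2 by (simp only: conj_commute)
qed

section \<open>The structure constants as sums over admissible cuts\<close>

lemma up_compl: "compl_in X (up X r) = lower X r"
  by (simp add: compl_in_def lower_def)

text \<open>A set with nonzero coefficient is up-closed, and if it is also a tree it consists of
  everything above its own root. The sum over sets becomes a sum over vertices because
  \<open>up W\<close> is injective.\<close>

lemma cut_coeff_eq:
  fixes q1 q2 :: "'c::finite \<Rightarrow> 'k::field"
  assumes q1: "\<And>j. q1 j = (if j \<in> p then 1 else 0)" and q2: "\<And>j. q2 j = 0"
  shows "cut_coeff q1 q2 t s w =
    cut_sum p (\<lambda>t' s'. if t' = t \<and> s' = s then 1 else 0) (rep_etree w)"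
proof -
  define W where "W = rep_etree w"
  have W: "is_tree W" by (simp add: W_def is_tree_rep_etree)
  note F = tree_forest[OF W]
  define P where "P A \<longleftrightarrow> is_tree (subforest W A) \<and> abs_etree (subforest W A) = s \<and>
     is_tree (subforest W (compl_in W A)) \<and> abs_etree (subforest W (compl_in W A)) = t" for A
  have up_inj: "inj_on (up W) (verts W)"
    using le_refl[OF F] le_antisym[OF F] by (fastforce intro!: inj_onI simp: up_def)
  have Pup: "P (up W r) \<longleftrightarrow> abs_etree (elower W r) = t \<and> abs_etree (eupper W r) = s"
    if "r \<in> verts W" "r \<noteq> root W" for r
    using is_tree_eupper[OF F that(1)] is_tree_elower[OF W that]
      abs_etree_subforest[OF F order_convex_up[OF F]] abs_etree_subforest[OF F order_convex_lower[OF F]]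
    unfolding P_def is_tree_subforest up_compl elower_def eupper_def by auto
  have qup: "qcoeff q1 q2 (up W r) W = (if r \<in> admissible p W then 1 else 0)"
    if r: "r \<in> verts W" "r \<noteq> root W" for r
  proof -
    \<comment> \<open>The colour condition at all vertices above \<open>r\<close> reduces to the one
      at \<open>r\<close>: by \<open>edge_path_up\<close> the relevant edges all lie on the path
      from \<open>r\<close>, and all edges on that path start outside \<open>up W r\<close>.\<close>
    have "(\<forall>v\<in>up W r. \<forall>a b. edge W a b \<longrightarrow> (b, v) \<in> le W \<longrightarrow> a \<notin> up W r \<longrightarrow> ecol W a b \<in> p) \<longleftrightarrow>
      (\<forall>a b. edge W a b \<longrightarrow> (b, r) \<in> le W \<longrightarrow> ecol W a b \<in> p)" (is "?L = ?R")
    proof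
      assume L: ?L
      have "a \<notin> up W r" if "edge W a b" "(b, r) \<in> le W" for a b
        using that le_trans[OF F] le_antisym[OF F] unfolding up_def edge_def by blast
      then show ?R using L le_refl[OF F r(1)] unfolding up_def by blast
    next
      assume R: ?R
      then show ?L using edge_path_up[OF F] unfolding up_def by blast
    qed
    moreover have "\<forall>a b. a \<in> up W r \<longrightarrow> (a, b) \<in> le W \<longrightarrow> b \<in> up W r"
      using le_trans[OF F] by (auto simp: up_def)
    ultimately show ?thesis
      using qcoeff_eq[of q1 p q2, OF q1 q2 W up_subset[OF F]] r by (simp add: admissible_def)
  qed
  have ex: "\<exists>r\<in>verts W. r \<noteq> root W \<and> A = up W r"
    if A: "A \<subseteq> verts W" "P A" and q: "qcoeff q1 q2 A W \<noteq> 0" for A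
  proof -
    have upA: "\<And>a b. a \<in> A \<Longrightarrow> (a, b) \<in> le W \<Longrightarrow> b \<in> A"
      using q qcoeff_eq[of q1 p q2, OF q1 q2 W A(1)] by (auto split: if_splits)
    have t: "is_tree (esub W A)" "is_tree (esub W (compl_in W A))"
      using A(2) unfolding P_def is_tree_subforest by auto
    let ?r = "root (esub W A)"
    have r: "?r \<in> A" "\<And>x. x \<in> A \<Longrightarrow> (?r, x) \<in> le W"
      using root_verts[OF t(1)] root_le[OF t(1)] by auto
    \<comment> \<open>The complement is a tree and therefore nonempty; an up-closed \<open>A\<close>
      containing the root of \<open>W\<close> would be everything. This excludes a cut at the
      root.\<close>
    have "compl_in W A \<noteq> {}" using root_verts[OF t(2)] by auto
    then have "root W \<notin> A" using upA root_le[OF W] by (auto simp: compl_in_def)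
    then have "?r \<noteq> root W" using r(1) by metis
    moreover have "A = up W ?r" using r upA unfolding up_def by blast
    ultimately show ?thesis using r(1) A(1) by (intro bexI[of _ ?r] conjI) blast+
  qed
  have "cut_coeff q1 q2 t s w = (\<Sum>A | A \<subseteq> verts W \<and> P A. qcoeff q1 q2 A W)"
    unfolding cut_coeff_def W_def P_def Let_def by (rule refl)
  also have "\<dots> = (\<Sum>A \<in> up W ` {r \<in> admissible p W. P (up W r)}. qcoeff q1 q2 A W)"
  proof (rule sum.mono_neutral_right)
    have "finite (Pow (verts W))" using finite_verts[OF F] by simp
    then show "finite {A. A \<subseteq> verts W \<and> P A}" by (rule rev_finite_subset) auto
    show "up W ` {r \<in> admissible p W. P (up W r)} \<subseteq> {A. A \<subseteq> verts W \<and> P A}"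
      using up_subset[OF F] by auto
    show "\<forall>A\<in>{A. A \<subseteq> verts W \<and> P A} - up W ` {r \<in> admissible p W. P (up W r)}. qcoeff q1 q2 A W = 0"
    proof (rule ballI, rule ccontr)
      fix A assume A: "A \<in> {A. A \<subseteq> verts W \<and> P A} - up W ` {r \<in> admissible p W. P (up W r)}"
        and q: "qcoeff q1 q2 A W \<noteq> 0"
      then obtain r where r: "r \<in> verts W" "r \<noteq> root W" "A = up W r" using ex by blast
      then have "r \<in> admissible p W" using qup[OF r(1,2)] q by (auto split: if_splits)
      then show False using A r by blast
    qed
  qed
  also have "\<dots> = (\<Sum>r\<in>{r \<in> admissible p W. P (up W r)}. qcoeff q1 q2 (up W r) W)"
    by (subst sum.reindex) (auto intro: inj_on_subset[OF up_inj] simp: admissible_def)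
  also have "\<dots> = (\<Sum>r\<in>admissible p W. if P (up W r) then 1 else 0)"
    unfolding sum.inter_filter[OF finite_admissible[OF W]] using qup
    by (intro sum.cong) (auto simp: admissible_def)
  also have "\<dots> = cut_sum p (\<lambda>t' s'. if t' = t \<and> s' = s then 1 else 0) W"
    unfolding cut_sum_def using Pup by (intro sum.cong) (auto simp: admissible_def)
  finally show ?thesis by (simp add: W_def)
qed

section \<open>Iterated cuts and the associator\<close>

lemma admissible_elower:
  assumes X: "is_tree X" and r': "r' \<in> verts X" "r' \<noteq> root X"
  shows "admissible p (elower X r') = {r \<in> admissible p X. (r', r) \<notin> le X}"
proof -
  note F = tree_forest[OF X]
  have v: "r \<in> verts (elower X r') \<longleftrightarrow> r \<in> verts X \<and> (r', r) \<notin> le X" for r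
    by (simp add: elower_def lower_def up_def)
  have e: "(edge (elower X r') a b \<and> (b, r) \<in> le (elower X r')) \<longleftrightarrow> edge X a b \<and> (b, r) \<in> le X"
    if r: "r \<in> verts X" "(r', r) \<notin> le X" for a b r
  proof -
    have "(r', b) \<notin> le X" if "(b, r) \<in> le X" using r(2) that le_trans[OF F] by blast
    then show ?thesis
      unfolding edge_elower[OF F] using r le_verts[OF F, of b r]
      by (auto simp: elower_def lower_def up_def)
  qed
  have "r \<in> admissible p (elower X r') \<longleftrightarrow> r \<in> admissible p X \<and> (r', r) \<notin> le X" for r
  proof -
    have "r \<in> admissible p (elower X r') \<longleftrightarrow> r \<in> verts X \<and> (r', r) \<notin> le X \<and> r \<noteq> root X \<and>
      (\<forall>a b. edge (elower X r') a b \<and> (b, r) \<in> le (elower X r') \<longrightarrow> ecol X a b \<in> p)"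
      unfolding admissible_def mem_Collect_eq v root_elower[OF X r'] by (auto simp: elower_def)
    also have "\<dots> \<longleftrightarrow> r \<in> admissible p X \<and> (r', r) \<notin> le X"
      unfolding admissible_def using e by (simp cong: conj_cong) blast
    finally show ?thesis .
  qed
  then show ?thesis by blast
qed

text \<open>Inside the upper part the path from \<open>r'\<close> ends at \<open>r\<close>. The rest
  of its path in \<open>X\<close> is the path from \<open>r\<close>, whose colours are in
  \<open>p\<close> because \<open>r\<close> is admissible. So admissibility in the part and in
  \<open>X\<close> agree, as the comparison of nested cuts requires.\<close>

lemma admissible_eupper:
  assumes X: "is_tree X" and r: "r \<in> admissible p X"
  shows "admissible p (eupper X r) = {r' \<in> admissible p X. r' \<noteq> r \<and> (r, r') \<in> le X}"
proof -
  note F = tree_forest[OF X]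
  have rV: "r \<in> verts X" "r \<noteq> root X"
    and rp: "\<And>a b. edge X a b \<Longrightarrow> (b, r) \<in> le X \<Longrightarrow> ecol X a b \<in> p"
    using r by (auto simp: admissible_def)
  have "r' \<in> admissible p (eupper X r) \<longleftrightarrow> r' \<in> admissible p X \<and> r' \<noteq> r \<and> (r, r') \<in> le X" for r'
  proof (cases "r' \<noteq> r \<and> (r, r') \<in> le X")
    case True
    then have l: "(r, r') \<in> le X" and rr: "r' \<noteq> r" by auto
    have n: "r' \<noteq> root X"
      using root_le[OF X rV(1)] le_antisym[OF F] l rr by blast
    have V: "r' \<in> verts X" using le_verts[OF F l] by simp
    have "(\<forall>a b. (r, a) \<in> le X \<and> edge X a b \<longrightarrow> (b, r') \<in> le X \<longrightarrow> ecol X a b \<in> p) \<longleftrightarrow>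
      (\<forall>a b. edge X a b \<longrightarrow> (b, r') \<in> le X \<longrightarrow> ecol X a b \<in> p)"
      using edge_path_up[OF F _ _ l] rp by blast
    moreover have "(b, r') \<in> le (eupper X r) \<longleftrightarrow> (b, r') \<in> le X" if "edge (eupper X r) a b" for a b
      using that l edge_eupper[OF F, of r a b] le_trans[OF F, of r a b]
      by (simp add: eupper_def up_def edge_def)
    ultimately have "(\<forall>a b. edge (eupper X r) a b \<longrightarrow> (b, r') \<in> le (eupper X r) \<longrightarrow> ecol X a b \<in> p) \<longleftrightarrow>
      (\<forall>a b. edge X a b \<longrightarrow> (b, r') \<in> le X \<longrightarrow> ecol X a b \<in> p)"
      by (simp add: edge_eupper[OF F])
    moreover have "verts (eupper X r) = up X r" "ecol (eupper X r) = ecol X"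
      by (simp_all add: eupper_def)
    ultimately show ?thesis
      unfolding admissible_def mem_Collect_eq root_eupper[OF F rV(1)]
      using n rr l V by (simp add: up_def)
  next
    case False
    then show ?thesis
      unfolding admissible_def mem_Collect_eq root_eupper[OF F rV(1)]
      by (auto simp: eupper_def up_def)
  qed
  then show ?thesis by blast
qed

context
  fixes X :: "'c epos"
  assumes X: "is_tree X"
begin

text \<open>This and the following equalities describe the parts after two cuts as subsets of the
  one poset \<open>X\<close>. They are equalities of posets, not only isomorphisms, since both
  restrictions collapse by \<open>esub_esub\<close>.\<close>

lemma elower_elower:
  "r \<in> lower X r' \<Longrightarrow> elower (elower X r') r = esub X (verts X - up X r - up X r')"
proof -
  assume "r \<in> lower X r'"
  then have "lower (elower X r') r = verts X - up X r - up X r'"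
    by (auto simp: elower_def lower_def up_def)
  then show ?thesis
    unfolding elower_def[of "elower X r'"] unfolding elower_def[of X]
    by (simp add: elower_def esub_esub lower_def Diff_mono)
qed

lemma eupper_elower:
  "r \<in> lower X r' \<Longrightarrow> eupper (elower X r') r = esub X (up X r - up X r')"
proof -
  assume r: "r \<in> lower X r'"
  have "up (elower X r') r = up X r - up X r'"
    using r up_subset[OF tree_forest[OF X], of r] by (auto simp: elower_def lower_def up_def)
  moreover have "up X r - up X r' \<subseteq> lower X r'"
    using up_subset[OF tree_forest[OF X], of r] by (auto simp: lower_def)
  ultimately show ?thesis
    by (simp add: eupper_def elower_def esub_esub)
qed

lemma up_eupper:
  "(r, r') \<in> le X \<Longrightarrow> up (eupper X r) r' = up X r'"
  using le_trans[OF tree_forest[OF X], of r r'] by (auto simp: eupper_def up_def)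

lemma eupper_eupper:
  "(r, r') \<in> le X \<Longrightarrow> eupper (eupper X r) r' = eupper X r'"
proof -
  assume l: "(r, r') \<in> le X"
  have "up X r' \<subseteq> up X r" using l le_trans[OF tree_forest[OF X], of r r'] by (auto simp: up_def)
  then show ?thesis
    unfolding eupper_def[of "eupper X r"] up_eupper[OF l]
    by (simp add: eupper_def esub_esub)
qed

lemma elower_eupper:
  "(r, r') \<in> le X \<Longrightarrow> elower (eupper X r) r' = esub X (up X r - up X r')"
  unfolding elower_def[of "eupper X r"] lower_def[of "eupper X r"]
  by (simp add: up_eupper) (simp add: eupper_def esub_esub Diff_subset)

end

text \<open>A pair of nested cuts contributes equally to both terms of the associator.\<close>

lemma cut_sum_associator:
  fixes F G H :: "'c etree \<Rightarrow> 'k::comm_ring"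
  assumes X: "is_tree X"
  defines "E \<equiv> \<lambda>A. abs_etree (esub X A)"
  shows "cut_sum p (\<lambda>t s. cut_sum p (\<lambda>t' s'. F t' * G s') (rep_etree t) * H s) X -
    cut_sum p (\<lambda>t s. F t * cut_sum p (\<lambda>t' s'. G t' * H s') (rep_etree s)) X =
    (\<Sum>r'\<in>admissible p X. \<Sum>r\<in>admissible p X. if (r, r') \<notin> le X \<and> (r', r) \<notin> le X
      then F (E (verts X - up X r - up X r')) * G (E (up X r)) * H (E (up X r')) else 0)"
    (is "?L - ?R = ?S")
proof -
  note f = tree_forest[OF X] and fin = finite_admissible[OF X, of p]
  have g: "r \<in> verts X" "r \<noteq> root X" if "r \<in> admissible p X" for r
    using that by (auto simp: admissible_def)
  \<comment> \<open>\<open>?T r r'\<close> comes from cutting at \<open>r'\<close> and then cutting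
    the lower part at \<open>r\<close>; \<open>?U r r'\<close> comes from cutting at
    \<open>r\<close> and then cutting the upper part at \<open>r'\<close>.\<close>
  let ?T = "\<lambda>r r'. F (E (verts X - up X r - up X r')) * G (E (up X r - up X r')) * H (E (up X r'))"
  let ?U = "\<lambda>r r'. F (E (verts X - up X r)) * G (E (up X r - up X r')) * H (E (up X r'))"
  have "?L = (\<Sum>r'\<in>admissible p X. \<Sum>r\<in>admissible p X. if (r', r) \<notin> le X then ?T r r' else 0)"
    unfolding cut_sum_def[of p _ X]
  proof (rule sum.cong[OF refl])
    fix r' assume r': "r' \<in> admissible p X"
    have "cut_sum p (\<lambda>t' s'. F t' * G s') (rep_etree (abs_etree (elower X r'))) =
      cut_sum p (\<lambda>t' s'. F t' * G s') (elower X r')"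
      by (rule cut_sum_rep[OF is_tree_elower[OF X g[OF r']]])
    also have "\<dots> = (\<Sum>r\<in>{r \<in> admissible p X. (r', r) \<notin> le X}.
        F (E (verts X - up X r - up X r')) * G (E (up X r - up X r')))"
      unfolding cut_sum_def admissible_elower[OF X g[OF r']] E_def
    proof (rule sum.cong[OF refl])
      fix r assume "r \<in> {r \<in> admissible p X. (r', r) \<notin> le X}"
      then have "r \<in> lower X r'" using g by (auto simp: lower_def up_def)
      then show "F (abs_etree (elower (elower X r') r)) * G (abs_etree (eupper (elower X r') r)) =
        F (abs_etree (esub X (verts X - up X r - up X r'))) * G (abs_etree (esub X (up X r - up X r')))"
        by (simp add: elower_elower[OF X] eupper_elower[OF X])
    qed
    finally show "cut_sum p (\<lambda>t' s'. F t' * G s') (rep_etree (abs_etree (elower X r'))) *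
        H (abs_etree (eupper X r')) = (\<Sum>r\<in>admissible p X. if (r', r) \<notin> le X then ?T r r' else 0)"
      unfolding sum.inter_filter[OF fin, symmetric]
      by (simp add: sum_distrib_right E_def eupper_def)
  qed
  moreover have "?R = (\<Sum>r\<in>admissible p X. \<Sum>r'\<in>admissible p X. if r' \<noteq> r \<and> (r, r') \<in> le X then ?U r r' else 0)"
    unfolding cut_sum_def[of p _ X]
  proof (rule sum.cong[OF refl])
    fix r assume r: "r \<in> admissible p X"
    have "cut_sum p (\<lambda>t' s'. G t' * H s') (rep_etree (abs_etree (eupper X r))) =
      cut_sum p (\<lambda>t' s'. G t' * H s') (eupper X r)"
      by (rule cut_sum_rep[OF is_tree_eupper[OF f g(1)[OF r]]])
    also have "\<dots> = (\<Sum>r'\<in>{r' \<in> admissible p X. r' \<noteq> r \<and> (r, r') \<in> le X}.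
        G (E (up X r - up X r')) * H (E (up X r')))"
      unfolding cut_sum_def admissible_eupper[OF X r] E_def
      by (intro sum.cong refl) (simp add: elower_eupper[OF X] eupper_eupper[OF X], simp add: eupper_def)
    finally show "F (abs_etree (elower X r)) *
        cut_sum p (\<lambda>t' s'. G t' * H s') (rep_etree (abs_etree (eupper X r))) =
        (\<Sum>r'\<in>admissible p X. if r' \<noteq> r \<and> (r, r') \<in> le X then ?U r r' else 0)"
      unfolding sum.inter_filter[OF fin, symmetric]
      by (simp add: sum_distrib_left E_def elower_def lower_def mult.assoc)
  qed
  moreover have "(\<Sum>r\<in>admissible p X. \<Sum>r'\<in>admissible p X. if r' \<noteq> r \<and> (r, r') \<in> le X then ?U r r' else 0) =
    (\<Sum>r'\<in>admissible p X. \<Sum>r\<in>admissible p X. if r' \<noteq> r \<and> (r, r') \<in> le X then ?U r r' else 0)"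
    by (rule sum.swap)
  ultimately have "?L - ?R = (\<Sum>r'\<in>admissible p X. \<Sum>r\<in>admissible p X.
    (if (r', r) \<notin> le X then ?T r r' else 0) - (if r' \<noteq> r \<and> (r, r') \<in> le X then ?U r r' else 0))"
    by (simp add: sum_subtractf)
  also have "\<dots> = ?S"
  proof (intro sum.cong refl)
    fix r r' assume rr: "r' \<in> admissible p X" "r \<in> admissible p X"
    \<comment> \<open>In the first case neither term occurs. In the second the up-set of
      \<open>r'\<close> is contained in that of \<open>r\<close>, so \<open>?T\<close> and
      \<open>?U\<close> agree and cancel. In the third the two up-sets are disjoint, and
      \<open>?T\<close> alone remains in a form that treats \<open>r\<close> and \<open>r'\<close>
      alike.\<close>
    consider "(r', r) \<in> le X" | "r' \<noteq> r" "(r, r') \<in> le X" "(r', r) \<notin> le X"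
      | "(r, r') \<notin> le X" "(r', r) \<notin> le X"
      using le_refl[OF f g(1)[OF rr(1)]] by blast
    then show "(if (r', r) \<notin> le X then ?T r r' else 0) -
      (if r' \<noteq> r \<and> (r, r') \<in> le X then ?U r r' else 0) =
      (if (r, r') \<notin> le X \<and> (r', r) \<notin> le X
       then F (E (verts X - up X r - up X r')) * G (E (up X r)) * H (E (up X r')) else 0)"
    proof cases
      case 1
      then have "\<not> (r' \<noteq> r \<and> (r, r') \<in> le X)" using le_antisym[OF f] by blast
      then show ?thesis using 1 by (simp only: if_False simp_thms) simp
    next
      case 2
      then have "up X r' \<subseteq> up X r" using le_trans[OF f] by (auto simp: up_def)
      then have "verts X - up X r - up X r' = verts X - up X r" by blast
      then show ?thesis using 2 by simp
    next
      case 3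
      have "x \<notin> up X r'" if "x \<in> up X r" for x
        using 3 that le_chain[OF f, of r x r'] by (auto simp: up_def)
      then have "up X r - up X r' = up X r" by blast
      then show ?thesis using 3 by simp
    qed
  qed
  finally show ?thesis .
qed

lemma cut_sum_pre_lie:
  fixes F G H :: "'c etree \<Rightarrow> 'k::comm_ring"
  assumes X: "is_tree X"
  shows "cut_sum p (\<lambda>t s. cut_sum p (\<lambda>t' s'. F t' * G s') (rep_etree t) * H s) X -
    cut_sum p (\<lambda>t s. F t * cut_sum p (\<lambda>t' s'. G t' * H s') (rep_etree s)) X =
    cut_sum p (\<lambda>t s. cut_sum p (\<lambda>t' s'. F t' * H s') (rep_etree t) * G s) X -
    cut_sum p (\<lambda>t s. F t * cut_sum p (\<lambda>t' s'. H t' * G s') (rep_etree s)) X"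
  unfolding cut_sum_associator[OF X]
  by (subst sum.swap) (intro sum.cong refl, simp add: conj_commute mult.commute mult.left_commute Diff_eq Int_ac)

section \<open>Finiteness of the set of trees of bounded size\<close>

text \<open>\<open>poset_iso\<close> speaks only about pairs of vertices, so that
  \<open>le Y\<close> relates nothing else has to be assumed.\<close>

lemma is_tree_iso:
  fixes X :: "'y poset_scheme" and Y :: "'z poset_scheme"
  assumes f: "poset_iso f X Y" and X: "is_tree X" and Y: "le Y \<subseteq> verts Y \<times> verts Y"
  shows "is_tree Y"
proof -
  note F = tree_forest[OF X]
  let ?g = "inv_into (verts X) f"
  have g: "bij_betw ?g (verts Y) (verts X)"
    "\<And>x y. x \<in> verts Y \<Longrightarrow> y \<in> verts Y \<Longrightarrow> (x, y) \<in> le Y \<longleftrightarrow> (?g x, ?g y) \<in> le X"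
    using poset_iso_inv[OF f] by (auto simp: poset_iso_def)
  have gV: "?g y \<in> verts X" if "y \<in> verts Y" for y using g(1) that by (rule bij_betw_apply)
  have inj: "x = y" if "x \<in> verts Y" "y \<in> verts Y" "?g x = ?g y" for x y
    using g(1) that by (auto simp: bij_betw_def inj_on_def)
  have YV: "x \<in> verts Y" "y \<in> verts Y" if "(x, y) \<in> le Y" for x y
    using that Y by auto
  have "finite (verts Y)" using g(1) finite_verts[OF F] bij_betw_finite by blast
  moreover have "partial_order_on (verts Y) (le Y)"
    unfolding partial_order_on_def preorder_on_def
  proof (intro conjI)
    show "le Y \<subseteq> verts Y \<times> verts Y" by fact
    show "refl_on (verts Y) (le Y)"
      unfolding refl_on_def using g(2) gV le_refl[OF F] by blast
    show "trans (le Y)"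
    proof (rule transI)
      fix x y z assume "(x, y) \<in> le Y" "(y, z) \<in> le Y"
      then show "(x, z) \<in> le Y" using g(2) YV le_trans[OF F] by metis
    qed
    show "antisym (le Y)"
    proof (rule antisymI)
      fix x y assume "(x, y) \<in> le Y" "(y, x) \<in> le Y"
      then show "x = y" using g(2) YV le_antisym[OF F] inj by metis
    qed
  qed
  moreover have "(y, z) \<in> le Y \<or> (z, y) \<in> le Y" if "(y, x) \<in> le Y" "(z, x) \<in> le Y" for x y z
    using le_chain[OF F, of "?g y" "?g x" "?g z"] g(2)[OF YV(1,2)[OF that(1)]]
      g(2)[OF YV(1,2)[OF that(2)]] g(2)[OF YV(1)[OF that(1)] YV(1)[OF that(2)]]
      g(2)[OF YV(1)[OF that(2)] YV(1)[OF that(1)]] that by blast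
  ultimately have FY: "is_forest Y" unfolding is_forest_def by blast
  have r: "f (root X) \<in> verts Y"
    using f root_verts[OF X] bij_betw_apply unfolding poset_iso_def by metis
  have "?g (f (root X)) = root X"
    using f root_verts[OF X] by (simp add: poset_iso_def bij_betw_def)
  then have "(f (root X), y) \<in> le Y" if "y \<in> verts Y" for y
    using g(2)[OF r that] root_le[OF X gV[OF that]] by simp
  then show ?thesis unfolding is_tree_def using FY r by blast
qed

text \<open>Numbering the vertices of a tree moves it onto an initial segment of the numbers below
  \<open>N\<close>, where there are finitely many orders and colourings. The lemma turns the degree
  bound in the graded dual into finite support, and makes the products finite sums.\<close>

lemma finite_esize_le: "finite {t :: 'c::finite etree. esize t \<le> N}"
proof -
  let ?S = "{..<N} \<times> {..<N}"
  let ?mk = "\<lambda>(A, R, c). \<lparr>verts = A, le = R, ecol = curry c\<rparr> :: 'c epos"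
  let ?D = "Pow {..<N} \<times> Pow ?S \<times> (PiE ?S (\<lambda>_. UNIV :: 'c set))"
  have mem: "t \<in> (abs_etree \<circ> ?mk) ` ?D" if t: "esize t \<le> N" for t :: "'c etree"
  proof -
    define X where "X = rep_etree t"
    have X: "is_tree X" by (simp add: X_def is_tree_rep_etree)
    note F = tree_forest[OF X]
    have tX: "abs_etree X = t" unfolding X_def by (rule Quotient_abs_rep[OF Quotient_etree])
    obtain f where f: "bij_betw f (verts X) {0..<card (verts X)}"
      using ex_bij_betw_finite_nat[OF finite_verts[OF F]] by blast
    have n: "{0..<card (verts X)} \<subseteq> {..<N}" using t by (auto simp: X_def esize_def)
    define g where "g = inv_into (verts X) f"
    have gf: "g (f x) = x" if "x \<in> verts X" for x
      using f that by (simp add: g_def bij_betw_def)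
    define A where "A = {0..<card (verts X)}"
    define R where "R = (\<lambda>(x, y). (f x, f y)) ` le X"
    \<comment> \<open>Restriction to the square fixes the value of \<open>c\<close> elsewhere, which
      leaves finitely many candidates for \<open>c\<close>.\<close>
    define c where "c = (\<lambda>z\<in>?S. ecol X (g (fst z)) (g (snd z)))"
    have fA: "f x \<in> A" if "x \<in> verts X" for x
      using f that unfolding A_def by (rule bij_betw_apply)
    have RA: "R \<subseteq> A \<times> A" using le_verts[OF F] fA by (auto simp: R_def)
    have iso: "poset_iso f X (?mk (A, R, c))"
    proof -
      have "(f x, f y) \<in> R \<longleftrightarrow> (x, y) \<in> le X" if xy: "x \<in> verts X" "y \<in> verts X" for x y
      proof
        assume "(f x, f y) \<in> R"
        then obtain x' y' where "(x', y') \<in> le X" "f x = f x'" "f y = f y'" by (auto simp: R_def)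
        then show "(x, y) \<in> le X" using le_verts[OF F] gf xy by metis
      qed (auto simp: R_def)
      then show ?thesis using f by (simp add: poset_iso_def A_def)
    qed
    have Y: "is_tree (?mk (A, R, c))" by (rule is_tree_iso[OF iso X]) (use RA in simp)
    have "ecol X v w = ecol (?mk (A, R, c)) (f v) (f w)" if "edge X v w" for v w
      using edge_verts[OF X that] fA n gf by (auto simp: c_def A_def subset_iff)
    then have "epos_iso X (?mk (A, R, c))" using iso by (auto simp: epos_iso_def)
    then have "t = (abs_etree \<circ> ?mk) (A, R, c)" using abs_etree_eq_iff[OF X Y] tX by simp
    moreover have "(A, R, c) \<in> ?D"
    proof -
      have "A \<subseteq> {..<N}" using n by (simp add: A_def)
      moreover from this have "R \<subseteq> ?S" using RA by blast
      moreover have "c \<in> PiE ?S (\<lambda>_. UNIV)" by (simp add: c_def)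
      ultimately show ?thesis by simp
    qed
    ultimately show ?thesis by (rule image_eqI)
  qed
  have "finite ?D" by (intro finite_cartesian_product finite_PiE) simp_all
  then have "finite ((abs_etree \<circ> ?mk) ` ?D)" by (rule finite_imageI)
  then show ?thesis by (rule rev_finite_subset) (rule subsetI, rule mem, simp)
qed

section \<open>Functionals on a space with a basis\<close>

lemma lookup_pscale [simp]: "Poly_Mapping.lookup (pscale c x) b = c * Poly_Mapping.lookup x b"
  by (simp add: pscale_def map.rep_eq when_def)

lemma lookup_basis: "Poly_Mapping.lookup (basis a) b = (if a = b then 1 else 0)"
  by (simp add: basis_def lookup_single when_def)

lemma keys_basis [simp]: "Poly_Mapping.keys (basis b :: _ \<Rightarrow>\<^sub>0 'k::field) = {b}"
  by (simp add: basis_def)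

interpretation pm: vector_space pscale
  by unfold_locales (auto intro!: poly_mapping_eqI simp: lookup_add algebra_simps)

interpretation fn: vector_space fscale
  by unfold_locales (auto simp: fscale_def algebra_simps)

lemma linear_functional_iff:
  "Vector_Spaces.linear pscale (*) (\<xi> :: ('b \<Rightarrow>\<^sub>0 'k::field) \<Rightarrow> 'k) \<longleftrightarrow>
    (\<forall>x y. \<xi> (x + y) = \<xi> x + \<xi> y) \<and> (\<forall>c x. \<xi> (pscale c x) = c * \<xi> x)"
proof -
  have "vector_space ((*) :: 'k \<Rightarrow> 'k \<Rightarrow> 'k)" by unfold_locales (auto simp: algebra_simps)
  then show ?thesis unfolding Vector_Spaces.linear_iff using pm.vector_space_axioms by blast
qed

lemma linear_functional_sum:
  assumes "Vector_Spaces.linear pscale (*) \<xi>"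
  shows "\<xi> (\<Sum>a\<in>A. pscale (c a) (f a)) = (\<Sum>a\<in>A. c a * \<xi> (f a))"
proof -
  have "\<xi> 0 = 0"
    using assms[unfolded linear_functional_iff] by (metis add_cancel_right_right)
  then show ?thesis
    using assms[unfolded linear_functional_iff]
    by (induction A rule: infinite_finite_induct) auto
qed

lemma basis_expansion:
  "x = (\<Sum>b\<in>Poly_Mapping.keys x. pscale (Poly_Mapping.lookup x b) (basis b))"
  by (rule poly_mapping_eqI)
    (auto simp: lookup_sum lookup_basis in_keys_iff if_distrib[of "\<lambda>y. _ * y"] cong: if_cong)

lemma linear_functional_expansion:
  assumes "Vector_Spaces.linear pscale (*) \<xi>"
  shows "\<xi> x = (\<Sum>b\<in>Poly_Mapping.keys x. Poly_Mapping.lookup x b * \<xi> (basis b))"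
  using linear_functional_sum[OF assms, of "Poly_Mapping.lookup x" basis "Poly_Mapping.keys x"]
    basis_expansion[of x] by simp

lemma sum_fun_apply: "sum F A x = (\<Sum>a\<in>A. F a x)"
  by (induction A rule: infinite_finite_induct) auto

section \<open>Primitive elements\<close>

text \<open>The finite linear combinations of the \<open>D_t\<close>, written without reference to
  the Hopf structure.\<close>

definition prims :: "(('c::finite eforest \<Rightarrow>\<^sub>0 'k::field) \<Rightarrow> 'k) set" where
  "prims = {\<xi>. Vector_Spaces.linear pscale (*) \<xi> \<and> (\<forall>u. size u \<noteq> 1 \<longrightarrow> \<xi> (basis u) = 0) \<and>
     finite {t. \<xi> (basis {#t#}) \<noteq> 0}}"

lemma tensor_basis: "tensor \<xi> \<eta> (basis (u, v)) = \<xi> (basis u) * \<eta> (basis v)"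
  by (simp add: tensor_def lookup_basis)

text \<open>Evaluated on a pair of forests, primitivity reads \<xi>(uv) = \<xi>(u) \<epsilon>(v) +
  \<epsilon>(u) \<xi>(v), with \<epsilon> the counit. For nonempty u and v the right side is 0, so
  \<xi> vanishes on forests with several trees; for u and v both empty it gives \<xi>(1) = 2
  \<xi>(1). Conversely these vanishing conditions give the equation on basis pairs, and linearity
  extends it.\<close>

lemma dual_primitives_eq:
  fixes q1 q2 :: "'c::finite \<Rightarrow> 'k::field"
  shows "dual_primitives (tree_hopf q1 q2) = prims"
proof (intro set_eqI iffI)
  let ?H = "tree_hopf q1 q2"
  fix \<xi> :: "('c eforest \<Rightarrow>\<^sub>0 'k) \<Rightarrow> 'k"
  have deg: "hdeg ?H {#t#} = esize t" for t by (simp add: tree_hopf_def esize_def)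
  have eps: "hcounit ?H (basis u) = (if u = {#} then 1 else 0)" for u
    by (simp add: tree_hopf_def lookup_basis)
  have mult: "hmult ?H x = (\<Sum>b\<in>Poly_Mapping.keys x.
      pscale (Poly_Mapping.lookup x b) (basis (fst b + snd b)))" for x
    by (simp add: tree_hopf_def lin_ext_def case_prod_beta)
  {
    assume "\<xi> \<in> dual_primitives ?H"
    then obtain N where lin: "Vector_Spaces.linear pscale (*) \<xi>"
      and N: "\<And>b. N < hdeg ?H b \<Longrightarrow> \<xi> (basis b) = 0"
      and d: "dual_comult ?H \<xi> = tensor \<xi> (hcounit ?H) + tensor (hcounit ?H) \<xi>"
      by (auto simp: dual_primitives_def graded_dual_def)
    have d': "\<xi> (basis (u + v)) = \<xi> (basis u) * hcounit ?H (basis v) + hcounit ?H (basis u) * \<xi> (basis v)"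
      for u v
      using fun_cong[OF d, of "basis (u, v)"]
      by (simp add: tensor_basis dual_comult_def mult lookup_basis)
    have "\<xi> (basis u) = 0" if "size u \<noteq> 1" for u
    proof (cases u)
      case empty
      have "\<xi> (basis {#}) = \<xi> (basis {#}) + \<xi> (basis {#})"
        using d'[of "{#}" "{#}"] by (simp only: eps if_True simp_thms add_0 mult_1_left mult_1_right)
      then show ?thesis using empty by (metis add_cancel_right_right)
    next
      case (add t v)
      then have "v \<noteq> {#}" using that by auto
      then show ?thesis using d'[of "{#t#}" v] add by (simp add: eps)
    qed
    moreover have "esize t \<le> N" if "\<xi> (basis {#t#}) \<noteq> 0" for t
      using N[of "{#t#}"] that unfolding deg by linarith
    then have "finite {t. \<xi> (basis {#t#}) \<noteq> 0}"
      by (intro finite_subset[OF _ finite_esize_le[of N]]) blast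
    ultimately show "\<xi> \<in> prims" using lin by (simp add: prims_def)
  next
    assume "\<xi> \<in> prims"
    then have lin: "Vector_Spaces.linear pscale (*) \<xi>"
      and z: "\<And>u. size u \<noteq> 1 \<Longrightarrow> \<xi> (basis u) = 0"
      and fin: "finite {t. \<xi> (basis {#t#}) \<noteq> 0}" by (auto simp: prims_def)
    \<comment> \<open>The sum bounds the size of every tree in the support and makes sense for empty
      support too.\<close>
    let ?N = "\<Sum>t | \<xi> (basis {#t#}) \<noteq> 0. esize t"
    have "\<xi> (basis u) = 0" if "?N < hdeg ?H u" for u
    proof (cases "size u = 1")
      case True
      then obtain t where u: "u = {#t#}" using size_1_singleton_mset by blast
      show ?thesis
      proof (rule ccontr)
        assume "\<xi> (basis u) \<noteq> 0"
        then have "esize t \<le> ?N" using member_le_sum[OF _ _ fin, of t esize] u by simp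
        then show False using that u deg by simp
      qed
    qed (use z in simp)
    then have "\<xi> \<in> graded_dual ?H" using lin unfolding graded_dual_def by blast
    moreover have "dual_comult ?H \<xi> = tensor \<xi> (hcounit ?H) + tensor (hcounit ?H) \<xi>"
    proof
      fix x
      have pt: "\<xi> (basis (u + v)) = \<xi> (basis u) * hcounit ?H (basis v) + hcounit ?H (basis u) * \<xi> (basis v)"
        for u v
        using z[of "u + v"] z[of "{#}"] by (cases u; cases v) (auto simp: eps)
      have "dual_comult ?H \<xi> x = (\<Sum>b\<in>Poly_Mapping.keys x.
          Poly_Mapping.lookup x b * \<xi> (basis (fst b + snd b)))"
        unfolding dual_comult_def mult by (rule linear_functional_sum[OF lin])
      also have "\<dots> = (tensor \<xi> (hcounit ?H) + tensor (hcounit ?H) \<xi>) x"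
        unfolding pt tensor_def
        by (simp add: case_prod_beta distrib_left sum.distrib)
      finally show "dual_comult ?H \<xi> x = (tensor \<xi> (hcounit ?H) + tensor (hcounit ?H) \<xi>) x" .
    qed
    ultimately show "\<xi> \<in> dual_primitives ?H" by (simp add: dual_primitives_def)
  }
qed

definition coef :: "(('c eforest \<Rightarrow>\<^sub>0 'k::field) \<Rightarrow> 'k) \<Rightarrow> 'c etree \<Rightarrow> 'k" where
  "coef \<xi> t = \<xi> (basis {#t#})"

lemma coef_simps [simp]:
  "coef (\<xi> + \<eta>) t = coef \<xi> t + coef \<eta> t"
  "coef (\<xi> - \<eta>) t = coef \<xi> t - coef \<eta> t"
  "coef (fscale c \<xi>) t = c * coef \<xi> t"
  "coef (sum F A) t = (\<Sum>a\<in>A. coef (F a) t)"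
  by (simp_all add: coef_def fscale_def sum_fun_apply)

lemma coef_D_tree: "coef (D_tree s) t = (if s = t then 1 else 0)"
  by (auto simp: coef_def dual_elem_def lookup_basis)

lemma prims_finite: "\<xi> \<in> prims \<Longrightarrow> finite {t. coef \<xi> t \<noteq> 0}"
  by (simp add: prims_def coef_def)

lemma subspace_prims:
  "fn.subspace (prims :: (('c::finite eforest \<Rightarrow>\<^sub>0 'k::field) \<Rightarrow> 'k) set)"
  unfolding fn.subspace_def
proof (intro conjI ballI allI)
  show "(0 :: ('c eforest \<Rightarrow>\<^sub>0 'k) \<Rightarrow> 'k) \<in> prims"
    by (simp add: prims_def linear_functional_iff)
  fix \<xi> \<eta> :: "('c eforest \<Rightarrow>\<^sub>0 'k) \<Rightarrow> 'k" and c
  assume \<xi>: "\<xi> \<in> prims"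
  show "fscale c \<xi> \<in> prims"
    using \<xi> unfolding prims_def linear_functional_iff
    by (auto simp: fscale_def algebra_simps elim!: rev_finite_subset)
  assume \<eta>: "\<eta> \<in> prims"
  have "finite {t. (\<xi> + \<eta>) (basis {#t#}) \<noteq> 0}"
    by (rule finite_subset[OF _ finite_UnI[OF prims_finite[OF \<xi>] prims_finite[OF \<eta>]]])
      (auto simp: coef_def)
  then show "\<xi> + \<eta> \<in> prims"
    using \<xi> \<eta> unfolding prims_def linear_functional_iff by (simp add: algebra_simps)
qed

lemma D_tree_prims: "D_tree t \<in> prims"
  unfolding prims_def linear_functional_iff
  by (auto simp: dual_elem_def lookup_add lookup_basis)

text \<open>A linear functional is determined on forests, and a primitive one vanishes on all
  forests but single trees. Identities between primitive elements can thus be checked one tree at a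
  time.\<close>

lemma prims_eqI:
  assumes "\<xi> \<in> prims" "\<eta> \<in> prims" "\<And>t. coef \<xi> t = coef \<eta> t"
  shows "\<xi> = \<eta>"
proof
  have "\<xi> (basis u) = \<eta> (basis u)" for u
  proof (cases "size u = 1")
    case True
    then obtain t where "u = {#t#}" using size_1_singleton_mset by blast
    then show ?thesis using assms(3)[of t] by (simp add: coef_def)
  qed (use assms(1,2) in \<open>simp add: prims_def\<close>)
  then show "\<xi> x = \<eta> x" for x
    using linear_functional_expansion[of \<xi> x] linear_functional_expansion[of \<eta> x] assms(1,2)
    by (simp add: prims_def)
qed

section \<open>The product of primitive elements in coordinates\<close>

context
  fixes p :: "'c::finite set" and q1 q2 :: "'c \<Rightarrow> 'k::field"
  assumes q1: "\<And>j. q1 j = (if j \<in> p then 1 else 0)" and q2: "\<And>j. q2 j = 0"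
begin

text \<open>A cut distributes the vertices of \<open>w\<close> over its two parts. Hence only
  finitely many \<open>w\<close> occur for given \<open>t\<close> and \<open>s\<close>, and the
  \<open>Sum_any\<close> over \<open>w\<close> is a genuine sum instead of the value
  \<open>0\<close> that it takes on infinite support.\<close>

lemma cut_coeff_nonzero:
  assumes "cut_coeff q1 q2 t s w \<noteq> 0"
  shows "esize t + esize s = esize w"
proof -
  obtain r where "r \<in> admissible p (rep_etree w)" "abs_etree (elower (rep_etree w) r) = t"
    "abs_etree (eupper (rep_etree w) r) = s"
  proof (rule ccontr)
    assume "\<not> thesis"
    then have "cut_coeff q1 q2 t s w = 0"
      unfolding cut_coeff_eq[of q1 p q2, OF q1 q2] cut_sum_def
      by (intro sum.neutral) (auto intro: that)
    then show False using assms by simp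
  qed
  then show ?thesis using admissible_esize[OF is_tree_rep_etree, of r p w] by (simp add: esize_def)
qed

lemma finite_cut_coeff: "finite {w. cut_coeff q1 q2 t s w \<noteq> 0}"
  by (rule finite_subset[OF _ finite_esize_le[of "esize t + esize s"]])
    (auto dest: cut_coeff_nonzero)

lemma cut_expansion:
  assumes "finite W" "{w. cut_coeff q1 q2 t s w \<noteq> 0} \<subseteq> W"
  shows "Sum_any (\<lambda>w. fscale (cut_coeff q1 q2 t s w) (D_tree w)) =
    (\<Sum>w\<in>W. fscale (cut_coeff q1 q2 t s w) (D_tree w))"
  by (rule Sum_any.expand_superset[OF assms(1)]) (use assms(2) in auto)

lemma cut_expansion_prims:
  "Sum_any (\<lambda>w. fscale (cut_coeff q1 q2 t s w) (D_tree w)) \<in> prims"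
  unfolding cut_expansion[OF finite_cut_coeff order_refl]
  by (intro fn.subspace_sum[OF subspace_prims] fn.subspace_scale[OF subspace_prims] D_tree_prims)

lemma coef_cut_expansion:
  "coef (Sum_any (\<lambda>w. fscale (cut_coeff q1 q2 t s w) (D_tree w))) w = cut_coeff q1 q2 t s w"
  unfolding cut_expansion[OF finite_cut_coeff order_refl]
  by (auto simp: coef_D_tree finite_cut_coeff if_distrib[of "\<lambda>y. _ * y"] cong: if_cong)

lemma prim_prod_expansion:
  assumes "\<xi> \<in> prims" "\<eta> \<in> prims"
  shows "prim_prod q1 q2 \<xi> \<eta> = (\<Sum>t | coef \<xi> t \<noteq> 0. \<Sum>s | coef \<eta> s \<noteq> 0.
    fscale (coef \<xi> t * coef \<eta> s) (Sum_any (\<lambda>w. fscale (cut_coeff q1 q2 t s w) (D_tree w))))"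
proof -
  let ?I = "\<lambda>t s. Sum_any (\<lambda>w. fscale (cut_coeff q1 q2 t s w) (D_tree w))"
  have "Sum_any (\<lambda>s. fscale (coef \<xi> t * coef \<eta> s) (?I t s)) =
    (\<Sum>s | coef \<eta> s \<noteq> 0. fscale (coef \<xi> t * coef \<eta> s) (?I t s))" for t
    by (rule Sum_any.expand_superset[OF prims_finite[OF assms(2)]]) auto
  moreover have "Sum_any (\<lambda>t. \<Sum>s | coef \<eta> s \<noteq> 0. fscale (coef \<xi> t * coef \<eta> s) (?I t s)) =
    (\<Sum>t | coef \<xi> t \<noteq> 0. \<Sum>s | coef \<eta> s \<noteq> 0. fscale (coef \<xi> t * coef \<eta> s) (?I t s))"
    by (rule Sum_any.expand_superset[OF prims_finite[OF assms(1)]]) (auto intro: ccontr)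
  ultimately show ?thesis unfolding prim_prod_def coef_def by simp
qed

lemma prim_prod_prims: "\<xi> \<in> prims \<Longrightarrow> \<eta> \<in> prims \<Longrightarrow> prim_prod q1 q2 \<xi> \<eta> \<in> prims"
  unfolding prim_prod_expansion
  by (intro fn.subspace_sum[OF subspace_prims] fn.subspace_scale[OF subspace_prims] cut_expansion_prims)

text \<open>Each cut of \<open>w\<close> belongs to exactly one pair of trees, the classes of its
  two parts. With the sum over cuts moved outside, the sums over \<open>t\<close> and
  \<open>s\<close> collapse to that pair; if the pair is outside the supports, its contribution is
  \<open>0\<close> anyway.\<close>

lemma coef_prim_prod:
  assumes "\<xi> \<in> prims" "\<eta> \<in> prims"
  shows "coef (prim_prod q1 q2 \<xi> \<eta>) w = cut_sum p (\<lambda>t s. coef \<xi> t * coef \<eta> s) (rep_etree w)"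
proof -
  let ?A = "{t. coef \<xi> t \<noteq> 0}" and ?B = "{t. coef \<eta> t \<noteq> 0}" and ?W = "rep_etree w"
  let ?l = "\<lambda>r. abs_etree (elower ?W r)" and ?u = "\<lambda>r. abs_etree (eupper ?W r)"
  note fin = prims_finite[OF assms(1)] prims_finite[OF assms(2)]
  have "coef (prim_prod q1 q2 \<xi> \<eta>) w = (\<Sum>t\<in>?A. \<Sum>s\<in>?B. coef \<xi> t * coef \<eta> s *
      (\<Sum>r\<in>admissible p ?W. if ?l r = t \<and> ?u r = s then 1 else 0))"
    unfolding prim_prod_expansion[OF assms]
    by (simp add: coef_cut_expansion) (simp add: cut_coeff_eq[of q1 p q2, OF q1 q2] cut_sum_def)
  also have "\<dots> = (\<Sum>t\<in>?A. \<Sum>s\<in>?B. \<Sum>r\<in>admissible p ?W.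
      if ?l r = t \<and> ?u r = s then coef \<xi> t * coef \<eta> s else 0)"
    by (simp add: sum_distrib_left if_distrib[of "\<lambda>y. _ * y"] cong: if_cong)
  also have "\<dots> = (\<Sum>t\<in>?A. \<Sum>r\<in>admissible p ?W. \<Sum>s\<in>?B.
      if ?l r = t \<and> ?u r = s then coef \<xi> t * coef \<eta> s else 0)"
    by (intro sum.cong refl sum.swap)
  also have "\<dots> = (\<Sum>r\<in>admissible p ?W. \<Sum>t\<in>?A. \<Sum>s\<in>?B.
      if ?l r = t \<and> ?u r = s then coef \<xi> t * coef \<eta> s else 0)"
    by (rule sum.swap)
  also have "\<dots> = (\<Sum>r\<in>admissible p ?W. coef \<xi> (?l r) * coef \<eta> (?u r))"
  proof (rule sum.cong[OF refl])
    fix r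
    have "(\<Sum>s\<in>?B. if ?l r = t \<and> ?u r = s then coef \<xi> t * coef \<eta> s else 0) =
      (if ?l r = t then coef \<xi> t * coef \<eta> (?u r) else 0)" for t
      using fin(2) by (cases "?l r = t") (auto simp: sum.delta)
    then show "(\<Sum>t\<in>?A. \<Sum>s\<in>?B. if ?l r = t \<and> ?u r = s then coef \<xi> t * coef \<eta> s else 0) =
      coef \<xi> (?l r) * coef \<eta> (?u r)"
      using fin(1) by (auto simp: sum.delta)
  qed
  finally show ?thesis by (simp add: cut_sum_def)
qed

lemma prim_prod_D_tree:
  "prim_prod q1 q2 (D_tree t) (D_tree s) = Sum_any (\<lambda>w. fscale (cut_coeff q1 q2 t s w) (D_tree w))"
proof (rule prims_eqI)
  show "prim_prod q1 q2 (D_tree t) (D_tree s) \<in> prims" by (intro prim_prod_prims D_tree_prims)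
  show "coef (prim_prod q1 q2 (D_tree t) (D_tree s)) w =
    coef (Sum_any (\<lambda>w. fscale (cut_coeff q1 q2 t s w) (D_tree w))) w" for w
    unfolding coef_cut_expansion coef_prim_prod[OF D_tree_prims D_tree_prims]
    unfolding cut_coeff_eq[of q1 p q2, OF q1 q2] cut_sum_def coef_D_tree by (intro sum.cong) auto
qed (rule cut_expansion_prims)

lemma pre_lie_prims: "pre_lie_algebra fscale prims (prim_prod q1 q2)"
proof (unfold_locales, goal_cases)
  case 1
  show ?case by (rule subspace_prims)
next
  case (2 \<xi> \<eta>)
  then show ?case by (rule prim_prod_prims)
next
  case (3 x y z)
  note m = prim_prod_prims fn.subspace_add[OF subspace_prims]
  show ?case
    by (rule prims_eqI)
      (simp_all add: 3 m coef_prim_prod cut_sum_def distrib_right sum.distrib)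
next
  case (4 x y z)
  note m = prim_prod_prims fn.subspace_add[OF subspace_prims]
  show ?case
    by (rule prims_eqI)
      (simp_all add: 4 m coef_prim_prod cut_sum_def distrib_left sum.distrib)
next
  case (5 x y c)
  note m = prim_prod_prims fn.subspace_scale[OF subspace_prims]
  show ?case
    by (rule prims_eqI)
      (simp_all add: 5 m coef_prim_prod cut_sum_def sum_distrib_left mult.assoc)
next
  case (6 x y c)
  note m = prim_prod_prims fn.subspace_scale[OF subspace_prims]
  show ?case
    by (rule prims_eqI)
      (simp_all add: 6 m coef_prim_prod cut_sum_def sum_distrib_left mult.left_commute)
next
  case (7 x y z)
  note m = prim_prod_prims fn.subspace_diff[OF subspace_prims]
  show ?case
    by (rule prims_eqI)
      (simp_all add: 7 m coef_prim_prod, rule cut_sum_pre_lie[OF is_tree_rep_etree])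
qed

end

section \<open>Isomorphisms of vertex-coloured trees\<close>

lemma is_tree_rep_vtree: "is_tree (rep_vtree t)"
  using Quotient_rep_reflp[OF Quotient_vtree] by blast

lemma vpos_iso_refl: "vpos_iso X X"
  unfolding vpos_iso_def by (rule exI[of _ id]) (simp add: poset_iso_id)

lemma abs_vtree_eq_iff:
  assumes "is_tree X" "is_tree Y"
  shows "abs_vtree X = abs_vtree Y \<longleftrightarrow> vpos_iso X Y"
  using Quotient_rel[OF Quotient_vtree, of X Y] assms vpos_iso_refl by blast

lemma abs_rep_vtree [simp]: "abs_vtree (rep_vtree t) = t"
  by (rule Quotient_abs_rep[OF Quotient_vtree])

lemma vpos_iso_rep_abs: "is_tree X \<Longrightarrow> vpos_iso X (rep_vtree (abs_vtree X))"
  using abs_vtree_eq_iff[OF _ is_tree_rep_vtree, of X "abs_vtree X"] by simp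

text \<open>Isomorphisms are made extensional so that maps agreeing on the vertices are counted once
  and the set is finite.\<close>

definition isos :: "'c vpos \<Rightarrow> 'c vpos \<Rightarrow> (nat \<Rightarrow> nat) set" where
  "isos X Y = {f \<in> extensional (verts X). poset_iso f X Y \<and> (\<forall>v\<in>verts X. vcol X v = vcol Y (f v))}"

lemma isos_extensional: "f \<in> isos X Y \<Longrightarrow> f \<in> extensional (verts X)"
  by (simp add: isos_def)

lemma isos_verts: "f \<in> isos X Y \<Longrightarrow> v \<in> verts X \<Longrightarrow> f v \<in> verts Y"
  by (auto simp: isos_def poset_iso_def intro: bij_betw_apply)

lemma finite_isos: "is_tree X \<Longrightarrow> is_tree Y \<Longrightarrow> finite (isos X Y)"
proof (rule finite_subset)
  show "isos X Y \<subseteq> PiE (verts X) (\<lambda>_. verts Y)"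
    using isos_verts[of _ X Y] isos_extensional[of _ X Y] by (simp add: PiE_def Pi_def subset_iff)
qed (intro finite_PiE finite_verts tree_forest)

lemma isos_restrict:
  assumes "poset_iso f X Y" "\<And>v. v \<in> verts X \<Longrightarrow> vcol X v = vcol Y (f v)"
  shows "restrict f (verts X) \<in> isos X Y"
  using assms unfolding isos_def poset_iso_def by (auto cong: bij_betw_cong)

lemma isos_empty_iff: "isos X Y = {} \<longleftrightarrow> \<not> vpos_iso X Y"
proof
  show "\<not> vpos_iso X Y" if "isos X Y = {}"
    using isos_restrict[of _ X Y] that unfolding vpos_iso_def by blast
  show "isos X Y = {}" if "\<not> vpos_iso X Y"
    using that unfolding vpos_iso_def isos_def by blast
qed

lemma isos_compose: "f \<in> isos X Y \<Longrightarrow> g \<in> isos Y Z \<Longrightarrow> compose (verts X) g f \<in> isos X Z"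
proof -
  assume f: "f \<in> isos X Y" and g: "g \<in> isos Y Z"
  have "poset_iso (g \<circ> f) X Z" using f g poset_iso_comp by (auto simp: isos_def)
  moreover have "vcol X v = vcol Z ((g \<circ> f) v)" if "v \<in> verts X" for v
    using f g isos_verts[OF f that] that by (auto simp: isos_def)
  ultimately show ?thesis using isos_restrict[of "g \<circ> f" X Z] by (simp add: compose_def comp_def)
qed

lemma isos_inj: "f \<in> isos X Y \<Longrightarrow> inj_on f (verts X)"
  and isos_image: "f \<in> isos X Y \<Longrightarrow> f ` verts X = verts Y"
  by (simp_all add: isos_def poset_iso_def bij_betw_def)

text \<open>Composition with a fixed isomorphism, on either side, is injective. Applied to an
  isomorphism and to its inverse, these inequalities become equalities.\<close>

lemma card_isos_le:
  assumes t: "is_tree X" "is_tree Y" "is_tree Z"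
  shows "vpos_iso Y Z \<Longrightarrow> card (isos X Y) \<le> card (isos X Z)"
    and "vpos_iso X Y \<Longrightarrow> card (isos Y Z) \<le> card (isos X Z)"
proof -
  assume "vpos_iso Y Z"
  then obtain g where g: "g \<in> isos Y Z" using isos_empty_iff by blast
  have "inj_on (compose (verts X) g) (isos X Y)"
  proof (rule inj_onI)
    fix f f' assume f: "f \<in> isos X Y" "f' \<in> isos X Y"
      and e: "compose (verts X) g f = compose (verts X) g f'"
    have "f x = f' x" if x: "x \<in> verts X" for x
    proof (rule inj_onD[OF isos_inj[OF g]])
      show "g (f x) = g (f' x)" using fun_cong[OF e, of x] x by (simp add: compose_def)
    qed (use isos_verts f x in auto)
    then show "f = f'" using f by (intro extensionalityI[of _ "verts X"]) (auto simp: isos_def)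
  qed
  then show "card (isos X Y) \<le> card (isos X Z)"
    using finite_isos[OF t(1,3)] isos_compose[OF _ g] by (intro card_inj_on_le) auto
next
  assume "vpos_iso X Y"
  then obtain g where g: "g \<in> isos X Y" using isos_empty_iff by blast
  have "inj_on (\<lambda>f. compose (verts X) f g) (isos Y Z)"
  proof (rule inj_onI)
    fix f f' assume f: "f \<in> isos Y Z" "f' \<in> isos Y Z"
      and e: "compose (verts X) f g = compose (verts X) f' g"
    have "f y = f' y" if y: "y \<in> verts Y" for y
    proof -
      obtain x where x: "x \<in> verts X" "y = g x" using y isos_image[OF g] by blast
      then show ?thesis using fun_cong[OF e, of x] by (simp add: compose_def)
    qed
    then show "f = f'" using f by (intro extensionalityI[of _ "verts Y"]) (auto simp: isos_def)
  qed
  then show "card (isos Y Z) \<le> card (isos X Z)"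
    using finite_isos[OF t(1,3)] isos_compose[OF g] by (intro card_inj_on_le) auto
qed

definition aut_card :: "'c vtree \<Rightarrow> nat" where
  "aut_card t = card (isos (rep_vtree t) (rep_vtree t))"

lemma aut_card_pos: "aut_card t > 0"
  unfolding aut_card_def card_gt_0_iff
  using finite_isos[OF is_tree_rep_vtree is_tree_rep_vtree] isos_empty_iff vpos_iso_refl by blast

text \<open>The isomorphisms between two trees, if there are any, form a torsor under the
  automorphism group. This is what converts counting isomorphisms into counting isomorphism
  classes.\<close>

lemma card_isos:
  assumes t: "is_tree X" "is_tree Y"
  shows "card (isos X Y) = (if abs_vtree X = abs_vtree Y then aut_card (abs_vtree Y) else 0)"
proof (cases "abs_vtree X = abs_vtree Y")
  case True
  let ?R = "rep_vtree (abs_vtree Y)"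
  have R: "is_tree ?R" by (rule is_tree_rep_vtree)
  have i: "vpos_iso X ?R" "vpos_iso ?R X" "vpos_iso Y ?R" "vpos_iso ?R Y"
    using True abs_vtree_eq_iff[OF _ R] abs_vtree_eq_iff[OF R] t abs_rep_vtree by metis+
  have "card (isos X Y) = card (isos ?R Y)"
    using card_isos_le(2)[OF t(1) R t(2) i(1)] card_isos_le(2)[OF R t i(2)] by simp
  also have "\<dots> = card (isos ?R ?R)"
    using card_isos_le(1)[OF R t(2) R i(3)] card_isos_le(1)[OF R R t(2) i(4)] by simp
  finally show ?thesis using True by (simp add: aut_card_def)
next
  case False
  then show ?thesis using abs_vtree_eq_iff[OF t] isos_empty_iff[of X Y] by simp
qed

section \<open>Grafting and cutting\<close>

definition vsub :: "'c vpos \<Rightarrow> nat set \<Rightarrow> 'c vpos" where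
  "vsub X A = \<lparr>verts = A, le = Restr (le X) A, vcol = vcol X\<rparr>"

lemma vsub_simps [simp]:
  "verts (vsub X A) = A" "le (vsub X A) = Restr (le X) A" "vcol (vsub X A) = vcol X"
  by (simp_all add: vsub_def)

definition vlower :: "'c vpos \<Rightarrow> nat \<Rightarrow> 'c vpos" where
  "vlower X r = vsub X (lower X r)"

definition vupper :: "'c vpos \<Rightarrow> nat \<Rightarrow> 'c vpos" where
  "vupper X r = vsub X (up X r)"

lemma is_tree_vupper: "is_forest X \<Longrightarrow> r \<in> verts X \<Longrightarrow> is_tree (vupper X r)"
  and root_vupper: "is_forest X \<Longrightarrow> r \<in> verts X \<Longrightarrow> root (vupper X r) = r"
  using is_tree_upper[of X r "vupper X r"] by (simp_all add: vupper_def)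

lemma is_tree_vlower: "is_tree X \<Longrightarrow> r \<in> verts X \<Longrightarrow> r \<noteq> root X \<Longrightarrow> is_tree (vlower X r)"
  using is_tree_lower[of X r "vlower X r"] by (simp_all add: vlower_def)

section \<open>The graft of two trees is a tree\<close>

lemma odd_neq_even: "Suc (2 * x) \<noteq> 2 * (y :: nat)" "2 * y \<noteq> Suc (2 * x)"
  by presburger+

lemma verts_graft: "verts (graft X v Z) = (\<lambda>x. 2 * x) ` verts X \<union> (\<lambda>z. 2 * z + 1) ` verts Z"
  by (simp add: graft_def)

lemma verts_graft_iff [simp]:
  "2 * x \<in> verts (graft X v Z) \<longleftrightarrow> x \<in> verts X"
  "Suc (2 * x) \<in> verts (graft X v Z) \<longleftrightarrow> x \<in> verts Z"
  by (auto simp: graft_def odd_neq_even)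

lemma le_graft_iff [simp]:
  "(2 * x, 2 * y) \<in> le (graft X v Z) \<longleftrightarrow> (x, y) \<in> le X"
  "(Suc (2 * x), Suc (2 * y)) \<in> le (graft X v Z) \<longleftrightarrow> (x, y) \<in> le Z"
  "(2 * x, Suc (2 * y)) \<in> le (graft X v Z) \<longleftrightarrow> (x, v) \<in> le X \<and> y \<in> verts Z"
  "(Suc (2 * x), 2 * y) \<notin> le (graft X v Z)"
  by (auto simp: graft_def odd_neq_even)

lemma vcol_graft [simp]:
  "vcol (graft X v Z) (2 * x) = vcol X x" "vcol (graft X v Z) (Suc (2 * x)) = vcol Z x"
  by (simp_all add: graft_def)

lemma parity_cases:
  obtains x :: nat where "y = 2 * x" | x where "y = Suc (2 * x)"
  using evenE[of y] oddE[of y] by (metis Suc_eq_plus1)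

context
  fixes X Z :: "'c vpos" and v :: nat
  assumes X: "is_tree X" and Z: "is_tree Z" and v: "v \<in> verts X"
begin

lemma root_graft_le: "y \<in> verts (graft X v Z) \<Longrightarrow> (2 * root X, y) \<in> le (graft X v Z)"
  by (cases y rule: parity_cases) (simp_all add: root_le[OF X] v)

text \<open>Every property splits by parity, that is, by the tree from which each vertex comes. In
  the chain condition, two vertices of \<open>X\<close> below a vertex of \<open>Z\<close> are both
  below \<open>v\<close> and hence comparable; a vertex of \<open>X\<close> and one of
  \<open>Z\<close> below a common vertex are comparable because the former is below \<open>v\<close>
  and so below all of \<open>Z\<close>.\<close>

lemma is_forest_graft: "is_forest (graft X v Z)"
proof -
  let ?G = "graft X v Z"
  note FX = tree_forest[OF X] and FZ = tree_forest[OF Z]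
  have V: "a \<in> verts ?G \<and> b \<in> verts ?G" if "(a, b) \<in> le ?G" for a b
  proof (cases a rule: parity_cases; cases b rule: parity_cases)
    fix x y assume "a = 2 * x" "b = 2 * y"
    then show ?thesis using that le_verts[OF FX, of x y] by simp
  next
    fix x y assume "a = 2 * x" "b = Suc (2 * y)"
    then show ?thesis using that le_verts[OF FX, of x v] by simp
  next
    fix x y assume "a = Suc (2 * x)" "b = Suc (2 * y)"
    then show ?thesis using that le_verts[OF FZ, of x y] by simp
  qed (use that in simp)
  have refl: "(a, a) \<in> le ?G" if "a \<in> verts ?G" for a
    using that by (cases a rule: parity_cases) (simp_all add: le_refl[OF FX] le_refl[OF FZ])
  have tr: "(a, c) \<in> le ?G" if ab: "(a, b) \<in> le ?G" and bc: "(b, c) \<in> le ?G" for a b c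
  proof -
    have [dest]: "\<And>x y. (x, y) \<in> le Z \<Longrightarrow> x \<in> verts Z \<and> y \<in> verts Z" using le_verts[OF FZ] .
    show ?thesis
      using ab bc
      by (cases a rule: parity_cases; cases b rule: parity_cases; cases c rule: parity_cases)
        (simp_all, (blast intro: le_trans[OF FX] le_trans[OF FZ])+)
  qed
  have anti: "a = b" if ab: "(a, b) \<in> le ?G" and ba: "(b, a) \<in> le ?G" for a b
    using ab ba
    by (cases a rule: parity_cases; cases b rule: parity_cases)
      (simp_all, (blast intro: le_antisym[OF FX] le_antisym[OF FZ])+)
  have chain: "(b, c) \<in> le ?G \<or> (c, b) \<in> le ?G"
    if ba: "(b, a) \<in> le ?G" and ca: "(c, a) \<in> le ?G" for a b c
  proof -
    have vZ: "(x, y) \<in> le Z \<Longrightarrow> x \<in> verts Z" for x y using le_verts[OF FZ] by blast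
    show ?thesis
      using ba ca
      by (cases a rule: parity_cases; cases b rule: parity_cases; cases c rule: parity_cases)
        (simp_all, (blast dest: vZ | blast dest: le_chain[OF FX] | blast dest: le_chain[OF FZ])+)
  qed
  have "finite (verts ?G)" using finite_verts[OF FX] finite_verts[OF FZ] by (simp add: verts_graft)
  moreover have "partial_order_on (verts ?G) (le ?G)"
    unfolding partial_order_on_def preorder_on_def
  proof (intro conjI)
    show "le ?G \<subseteq> verts ?G \<times> verts ?G" using V by auto
    show "refl_on (verts ?G) (le ?G)" using refl by (rule refl_onI)
    show "trans (le ?G)" using tr by (rule transI)
    show "antisym (le ?G)" using anti by (rule antisymI)
  qed
  ultimately show ?thesis unfolding is_forest_def using chain by blast
qed

lemma is_tree_graft: "is_tree (graft X v Z)"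
  unfolding is_tree_def using is_forest_graft root_graft_le root_verts[OF X]
  by (intro conjI bexI[of _ "2 * root X"]) auto

end

text \<open>Injective although \<open>v\<close> is dropped: \<open>v\<close> is recovered as the vertex that corresponds to the
  parent of the cut vertex.\<close>

definition split_iso ::
  "'c vpos \<Rightarrow> 'c vpos \<Rightarrow> nat \<times> (nat \<Rightarrow> nat) \<Rightarrow> nat \<times> (nat \<Rightarrow> nat) \<times> (nat \<Rightarrow> nat)" where
  "split_iso X Z = (\<lambda>(v, h). (h (Suc (2 * root Z)),
     restrict (\<lambda>x. h (2 * x)) (verts X), restrict (\<lambda>z. h (Suc (2 * z))) (verts Z)))"

context
  fixes X Y Z :: "'c vpos"
  assumes X: "is_tree X" and Y: "is_tree Y" and Z: "is_tree Z"
begin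

lemma split_iso_inj: "inj_on (split_iso X Z) (SIGMA v:verts X. isos (graft X v Z) Y)"
proof (rule inj_onI, clarify)
  note FX = tree_forest[OF X]
  fix v h w k
  assume v: "v \<in> verts X" and h: "h \<in> isos (graft X v Z) Y"
    and w: "w \<in> verts X" and k: "k \<in> isos (graft X w Z) Y"
    and eq: "split_iso X Z (v, h) = split_iso X Z (w, k)"
  have ev: "h (2 * x) = k (2 * x)" if "x \<in> verts X" for x
    using eq that unfolding split_iso_def prod.case prod.inject by (metis restrict_apply')
  have od: "h (Suc (2 * z)) = k (Suc (2 * z))" if "z \<in> verts Z" for z
    using eq that unfolding split_iso_def prod.case prod.inject by (metis restrict_apply')
  have "h y = k y" if "y \<in> verts (graft X v Z)" for y
    using that ev od by (cases y rule: parity_cases) simp_all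
  \<comment> \<open>The vertex set of a graft does not depend on the grafting vertex, so
    \<open>h\<close> and \<open>k\<close> are extensional on the same set.\<close>
  moreover have "k \<in> extensional (verts (graft X v Z))" "h \<in> extensional (verts (graft X v Z))"
    using h k by (simp_all add: isos_def verts_graft)
  ultimately have hk: "h = k" by (metis extensionalityI)
  \<comment> \<open>In the graft, the vertices of \<open>X\<close> below the root of
    \<open>Z\<close> are those below the grafting vertex. The common map thus determines the
    down-set of that vertex, and with it the vertex.\<close>
  have "(x, v) \<in> le X \<longleftrightarrow> (x, w) \<in> le X" if x: "x \<in> verts X" for x
  proof -
    have "(h a, h b) \<in> le Y \<longleftrightarrow> (a, b) \<in> le (graft X v Z)"
      "(k a, k b) \<in> le Y \<longleftrightarrow> (a, b) \<in> le (graft X w Z)"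
      if "a \<in> verts (graft X v Z)" "b \<in> verts (graft X v Z)" for a b
      using h k that by (simp_all add: isos_def poset_iso_def verts_graft)
    from this[of "2 * x" "Suc (2 * root Z)"] show ?thesis
      using hk x root_verts[OF Z] by simp
  qed
  then show "v = w \<and> h = k" using hk v w le_refl[OF FX] le_antisym[OF FX] by blast
qed

lemma split_iso_into:
  assumes v: "v \<in> verts X" and h: "h \<in> isos (graft X v Z) Y"
  shows "split_iso X Z (v, h) \<in>
    (SIGMA r:verts Y - {root Y}. isos X (vlower Y r) \<times> isos Z (vupper Y r))"
proof -
  let ?G = "graft X v Z"
  define r where "r = h (Suc (2 * root Z))"
  note FY = tree_forest[OF Y]
  have G: "is_tree ?G" by (rule is_tree_graft[OF X Z v])
  have o: "(h a, h b) \<in> le Y \<longleftrightarrow> (a, b) \<in> le ?G" if "a \<in> verts ?G" "b \<in> verts ?G" for a b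
    using h that by (simp add: isos_def poset_iso_def)
  have c: "vcol Y (h a) = vcol ?G a" if "a \<in> verts ?G" for a
    using h that by (simp add: isos_def)
  have rZ: "Suc (2 * root Z) \<in> verts ?G" using root_verts[OF Z] by simp
  have rV: "r \<in> verts Y" unfolding r_def by (rule isos_verts[OF h rZ])
  \<comment> \<open>Otherwise the copy of the root of \<open>Z\<close> would lie below the copy of
    \<open>v\<close>, but no vertex of \<open>Z\<close> is below one of \<open>X\<close>.\<close>
  have "r \<noteq> root Y"
  proof
    assume "r = root Y"
    then have "(r, h (2 * v)) \<in> le Y" using root_le[OF Y] isos_verts[OF h, of "2 * v"] v by simp
    then show False unfolding r_def using o[OF rZ, of "2 * v"] v by simp
  qed
  have ev: "h (2 * x) \<in> lower Y r" if "x \<in> verts X" for x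
    unfolding lower_def up_def r_def using o[OF rZ, of "2 * x"] that isos_verts[OF h, of "2 * x"] by simp
  have od: "h (Suc (2 * z)) \<in> up Y r" if "z \<in> verts Z" for z
    unfolding up_def r_def using o[OF rZ, of "Suc (2 * z)"] that root_le[OF Z] by simp
  have im: "\<exists>a\<in>verts ?G. y = h a" if "y \<in> verts Y" for y
    using isos_image[OF h] that by blast
  have "(\<lambda>x. h (2 * x)) ` verts X = lower Y r"
  proof (intro equalityI subsetI)
    fix y assume y: "y \<in> lower Y r"
    then obtain a where a: "a \<in> verts ?G" "y = h a" using im unfolding lower_def by blast
    show "y \<in> (\<lambda>x. h (2 * x)) ` verts X"
      by (cases a rule: parity_cases) (use a y od in \<open>auto simp: lower_def\<close>)
  qed (use ev in blast)
  moreover have "(\<lambda>z. h (Suc (2 * z))) ` verts Z = up Y r"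
  proof (intro equalityI subsetI)
    fix y assume y: "y \<in> up Y r"
    then have "y \<in> verts Y" using up_subset[OF FY] by blast
    then obtain a where a: "a \<in> verts ?G" "y = h a" using im by blast
    show "y \<in> (\<lambda>z. h (Suc (2 * z))) ` verts Z"
      by (cases a rule: parity_cases) (use a y ev in \<open>auto simp: lower_def\<close>)
  qed (use od in blast)
  moreover have "inj_on (\<lambda>x. h (2 * x)) (verts X)" "inj_on (\<lambda>z. h (Suc (2 * z))) (verts Z)"
    using inj_onD[OF isos_inj[OF h]] by (fastforce intro!: inj_onI)+
  ultimately have "poset_iso (\<lambda>x. h (2 * x)) X (vlower Y r)"
    "poset_iso (\<lambda>z. h (Suc (2 * z))) Z (vupper Y r)"
    using ev od o by (simp_all add: poset_iso_def bij_betw_def vlower_def vupper_def)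
  then have "restrict (\<lambda>x. h (2 * x)) (verts X) \<in> isos X (vlower Y r)"
    "restrict (\<lambda>z. h (Suc (2 * z))) (verts Z) \<in> isos Z (vupper Y r)"
    using c by (auto intro!: isos_restrict simp: vlower_def vupper_def)
  then show ?thesis
    using rV \<open>r \<noteq> root Y\<close> by (simp add: split_iso_def r_def[symmetric])
qed

text \<open>The grafting vertex must be the one that \<open>f\<close> sends to the parent
  \<open>a\<close> of \<open>r\<close>. Gluing \<open>f\<close> and \<open>g\<close> along the
  parity then gives the inverse image.\<close>

lemma split_iso_onto:
  assumes r: "r \<in> verts Y" "r \<noteq> root Y"
    and f: "f \<in> isos X (vlower Y r)" and g: "g \<in> isos Z (vupper Y r)"
  shows "(r, f, g) \<in> split_iso X Z ` (SIGMA v:verts X. isos (graft X v Z) Y)"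
proof -
  note FY = tree_forest[OF Y]
  have "(root Y, r) \<in> le Y" "root Y \<noteq> r" using root_le[OF Y] r by auto
  then obtain a where a: "edge Y a r" using edge_below[OF FY] by blast
  have ar: "(a, r) \<in> le Y" "a \<noteq> r" using a by (auto simp: edge_def)
  have "(r, a) \<notin> le Y" using ar le_antisym[OF FY] by blast
  then have "a \<in> lower Y r" using le_verts[OF FY ar(1)] by (simp add: lower_def up_def)
  then have "a \<in> f ` verts X" using isos_image[OF f] by (simp add: vlower_def)
  then obtain v where v: "v \<in> verts X" "f v = a" by blast
  let ?G = "graft X v Z"
  define h where "h = restrict (\<lambda>y. if even y then f (y div 2) else g (y div 2)) (verts ?G)"
  have hev: "h (2 * x) = f x" if "x \<in> verts X" for x using that by (simp add: h_def)
  have hod: "h (Suc (2 * z)) = g z" if "z \<in> verts Z" for z using that by (simp add: h_def)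
  have fl: "f x \<in> verts Y" "(r, f x) \<notin> le Y" if "x \<in> verts X" for x
    using isos_verts[OF f that] by (auto simp: vlower_def lower_def up_def)
  have gu: "g z \<in> verts Y" "(r, g z) \<in> le Y" if "z \<in> verts Z" for z
    using isos_verts[OF g that] le_verts[OF FY] by (auto simp: vupper_def up_def)
  have fo: "(f x, f y) \<in> le Y \<longleftrightarrow> (x, y) \<in> le X" if "x \<in> verts X" "y \<in> verts X" for x y
    using f that isos_verts[OF f] by (auto simp: isos_def poset_iso_def vlower_def)
  have go: "(g x, g y) \<in> le Y \<longleftrightarrow> (x, y) \<in> le Z" if "x \<in> verts Z" "y \<in> verts Z" for x y
    using g that isos_verts[OF g] by (auto simp: isos_def poset_iso_def vupper_def)
  \<comment> \<open>This is the only order relation not given by \<open>f\<close> or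
    \<open>g\<close> alone: a vertex of the lower part is below one of the upper part iff it is
    below \<open>r\<close>, and, being different from \<open>r\<close>, iff it is below the parent
    of \<open>r\<close>.\<close>
  have fg: "(f x, g z) \<in> le Y \<longleftrightarrow> (x, v) \<in> le X" if x: "x \<in> verts X" and z: "z \<in> verts Z" for x z
  proof -
    have "(f x, g z) \<in> le Y \<longleftrightarrow> (f x, r) \<in> le Y"
      using le_chain[OF FY, of "f x" "g z" r] le_trans[OF FY, of "f x" r "g z"] gu[OF z] fl[OF x]
      by blast
    also have "\<dots> \<longleftrightarrow> (f x, a) \<in> le Y"
      using edge_lower_unique[OF FY a, of "f x"] le_trans[OF FY _ ar(1), of "f x"]
        fl[OF x] le_refl[OF FY r(1)] by metis
    also have "\<dots> \<longleftrightarrow> (x, v) \<in> le X" using fo[OF x v(1)] v(2) by simp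
    finally show ?thesis .
  qed
  have gf: "(g z, f x) \<notin> le Y" if "x \<in> verts X" "z \<in> verts Z" for x z
    using le_trans[OF FY, of r "g z" "f x"] gu[OF that(2)] fl[OF that(1)] by blast
  have "bij_betw h (verts ?G) (lower Y r \<union> up Y r)"
    unfolding verts_graft
  proof (rule bij_betw_combine)
    show "bij_betw h ((\<lambda>x. 2 * x) ` verts X) (lower Y r)"
      using isos_inj[OF f] isos_image[OF f] hev
      by (auto simp: bij_betw_def inj_on_def vlower_def image_image)
    show "bij_betw h ((\<lambda>z. 2 * z + 1) ` verts Z) (up Y r)"
      using isos_inj[OF g] isos_image[OF g] hod
      by (auto simp: bij_betw_def inj_on_def vupper_def image_image)
  qed (auto simp: lower_def)
  moreover have "lower Y r \<union> up Y r = verts Y" using up_subset[OF FY] by (auto simp: lower_def)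
  moreover have "(h b, h c) \<in> le Y \<longleftrightarrow> (b, c) \<in> le ?G" if "b \<in> verts ?G" "c \<in> verts ?G" for b c
    using that
    by (cases b rule: parity_cases; cases c rule: parity_cases) (simp_all add: hev hod fo go fg gf)
  ultimately have iso: "poset_iso h ?G Y" by (simp add: poset_iso_def)
  moreover have "vcol ?G b = vcol Y (h b)" if "b \<in> verts ?G" for b
    using that f g
    by (cases b rule: parity_cases) (simp_all add: hev hod isos_def vlower_def vupper_def)
  ultimately have "h \<in> isos ?G Y" by (simp add: isos_def h_def)
  moreover have "split_iso X Z (v, h) = (r, f, g)"
  proof -
    have "g (root Z) = r"
      using iso_root[of g Z "vupper Y r"] g Z is_tree_vupper[OF FY r(1)] root_vupper[OF FY r(1)]
      by (simp add: isos_def)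
    moreover have "restrict (\<lambda>x. h (2 * x)) (verts X) = f" "restrict (\<lambda>z. h (Suc (2 * z))) (verts Z) = g"
      using f g hev hod by (auto simp: fun_eq_iff isos_def extensional_def restrict_def)
    ultimately show ?thesis using hod[OF root_verts[OF Z]] by (simp add: split_iso_def)
  qed
  ultimately show ?thesis using v(1) by force
qed

lemma card_graft_isos:
  "(\<Sum>v\<in>verts X. card (isos (graft X v Z) Y)) =
   (\<Sum>r\<in>verts Y - {root Y}. card (isos X (vlower Y r)) * card (isos Z (vupper Y r)))"
proof -
  let ?A = "SIGMA v:verts X. isos (graft X v Z) Y"
  let ?B = "SIGMA r:verts Y - {root Y}. isos X (vlower Y r) \<times> isos Z (vupper Y r)"
  note F = tree_forest
  have "split_iso X Z ` ?A = ?B"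
  proof (intro equalityI subsetI)
    fix b assume "b \<in> split_iso X Z ` ?A"
    then obtain v h where "b = split_iso X Z (v, h)" "v \<in> verts X" "h \<in> isos (graft X v Z) Y"
      by blast
    then show "b \<in> ?B" by (simp only: split_iso_into)
  next
    fix b assume "b \<in> ?B"
    then obtain r f g where b: "b = (r, f, g)" and m: "r \<in> verts Y" "r \<noteq> root Y"
      "f \<in> isos X (vlower Y r)" "g \<in> isos Z (vupper Y r)" by blast
    show "b \<in> split_iso X Z ` ?A" unfolding b by (rule split_iso_onto[OF m])
  qed
  then have "card ?B = card ?A" using card_image[OF split_iso_inj] by metis
  moreover have "card ?A = (\<Sum>v\<in>verts X. card (isos (graft X v Z) Y))"
    using finite_isos[OF is_tree_graft[OF X Z] Y] finite_verts[OF F[OF X]] by (intro card_SigmaI) auto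
  moreover have "card ?B = (\<Sum>r\<in>verts Y - {root Y}. card (isos X (vlower Y r)) * card (isos Z (vupper Y r)))"
    using finite_isos[OF X is_tree_vlower[OF Y]] finite_isos[OF Z is_tree_vupper[OF F[OF Y]]]
      finite_verts[OF F[OF Y]] by (subst card_SigmaI) (auto simp: card_cartesian_product)
  ultimately show ?thesis by simp
qed

end

text \<open>The comparison of structure constants: the cardinality on the left is the coefficient of
  \<open>y\<close> in the grafting product of \<open>x\<close> and \<open>z\<close>, and the right
  side is the number of cuts of \<open>y\<close> into \<open>x\<close> and \<open>z\<close>,
  weighted by automorphisms. Both sides count isomorphisms from grafts onto \<open>Y\<close>, by
  \<open>card_graft_isos\<close>.\<close>

lemma graft_count:
  fixes x y z :: "'c vtree"
  defines "Y \<equiv> rep_vtree y"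
  shows "card {v \<in> verts (rep_vtree x). abs_vtree (graft (rep_vtree x) v (rep_vtree z)) = y} * aut_card y =
    (\<Sum>r\<in>verts Y - {root Y}.
      if x = abs_vtree (vlower Y r) \<and> z = abs_vtree (vupper Y r) then aut_card x * aut_card z else 0)"
proof -
  let ?X = "rep_vtree x" and ?Z = "rep_vtree z"
  note t = is_tree_rep_vtree
  have Y: "is_tree Y" by (simp add: Y_def t)
  have Yy: "abs_vtree Y = y" by (simp add: Y_def)
  have "(\<Sum>v\<in>verts ?X. card (isos (graft ?X v ?Z) Y)) =
    (\<Sum>v\<in>verts ?X. if abs_vtree (graft ?X v ?Z) = y then aut_card y else 0)"
    by (intro sum.cong refl) (simp add: card_isos[OF is_tree_graft[OF t t] Y] Yy)
  also have "\<dots> = card {v \<in> verts ?X. abs_vtree (graft ?X v ?Z) = y} * aut_card y"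
    using finite_verts[OF tree_forest[OF t[of x]]] by (simp add: sum.inter_filter[symmetric])
  finally have "card {v \<in> verts ?X. abs_vtree (graft ?X v ?Z) = y} * aut_card y =
    (\<Sum>r\<in>verts Y - {root Y}. card (isos ?X (vlower Y r)) * card (isos ?Z (vupper Y r)))"
    using card_graft_isos[OF t[of x] Y t[of z]] by simp
  also have "\<dots> = (\<Sum>r\<in>verts Y - {root Y}.
      if x = abs_vtree (vlower Y r) \<and> z = abs_vtree (vupper Y r) then aut_card x * aut_card z else 0)"
    by (intro sum.cong refl)
      (simp add: card_isos[OF t is_tree_vlower[OF Y]] card_isos[OF t is_tree_vupper[OF tree_forest[OF Y]]])
  finally show ?thesis .
qed

section \<open>Forgetting the colour of the root\<close>

definition epos_of :: "'c vpos \<Rightarrow> 'c epos" where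
  "epos_of X = \<lparr>verts = verts X, le = le X, ecol = (\<lambda>v w. vcol X w)\<rparr>"

lemma epos_of_simps [simp]:
  "verts (epos_of X) = verts X" "le (epos_of X) = le X" "ecol (epos_of X) v w = vcol X w"
  by (simp_all add: epos_of_def)

lemma is_tree_epos_of [simp]: "is_tree (epos_of X) = is_tree X"
  by (rule is_tree_cong) simp_all

lemma root_epos_of [simp]: "root (epos_of X) = root X"
  by (rule root_cong) simp_all

lemma edge_cong:
  fixes X :: "'z poset_scheme" and Y :: "'y poset_scheme"
  shows "le X = le Y \<Longrightarrow> edge X v w \<longleftrightarrow> edge Y v w"
  by (simp add: edge_def)

lemma edge_epos_of [simp]: "edge (epos_of X) v w \<longleftrightarrow> edge X v w"
  by (rule edge_cong) simp

lemma edge_root: "is_tree X \<Longrightarrow> edge X a w \<Longrightarrow> w \<noteq> root X"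
  using root_le[of X a] edge_verts[of X a w] le_antisym[OF tree_forest, of X a w]
  by (auto simp: edge_def)

text \<open>The colour of an edge depends only on its upper vertex, which keeps its colour in every
  part. Cutting and moving colours therefore commute.\<close>

lemma elower_epos_of: "elower (epos_of X) r = epos_of (vlower X r)"
  and eupper_epos_of: "eupper (epos_of X) r = epos_of (vupper X r)"
  by (simp_all add: elower_def vlower_def eupper_def vupper_def esub_def vsub_def epos_of_def
      lower_def up_def fun_eq_iff)

definition forget_root :: "'c vtree \<Rightarrow> 'c etree" where
  "forget_root x = abs_etree (epos_of (rep_vtree x))"

lemma vpos_iso_epos_of: "is_tree X \<Longrightarrow> vpos_iso X Y \<Longrightarrow> epos_iso (epos_of X) (epos_of Y)"
proof -
  assume X: "is_tree X" and "vpos_iso X Y"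
  then obtain f where f: "poset_iso f X Y" "\<And>v. v \<in> verts X \<Longrightarrow> vcol X v = vcol Y (f v)"
    unfolding vpos_iso_def by blast
  have "poset_iso f (epos_of X) (epos_of Y)" using f(1) by (simp add: poset_iso_def)
  moreover have "ecol (epos_of X) v w = ecol (epos_of Y) (f v) (f w)" if "edge (epos_of X) v w" for v w
    using that f(2) edge_verts[OF X] by simp
  ultimately show ?thesis unfolding epos_iso_def by blast
qed

lemma forget_root_abs: "is_tree X \<Longrightarrow> forget_root (abs_vtree X) = abs_etree (epos_of X)"
proof -
  assume X: "is_tree X"
  have "epos_iso (epos_of X) (epos_of (rep_vtree (abs_vtree X)))"
    by (rule vpos_iso_epos_of[OF X vpos_iso_rep_abs[OF X]])
  then show ?thesis
    using abs_etree_eq_iff[of "epos_of X" "epos_of (rep_vtree (abs_vtree X))"] X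
    by (simp add: forget_root_def is_tree_rep_vtree)
qed

lemma surj_forget_root: "\<exists>x. forget_root x = t"
proof -
  define X where "X = rep_etree t"
  have X: "is_tree X" and t: "abs_etree X = t"
    unfolding X_def by (rule is_tree_rep_etree, rule Quotient_abs_rep[OF Quotient_etree])
  \<comment> \<open>A vertex gets the colour of the edge from its parent. The root has no parent,
    and the unspecified value of \<open>THE\<close> gives it some colour.\<close>
  let ?Y = "\<lparr>verts = verts X, le = le X, vcol = (\<lambda>w. ecol X (THE a. edge X a w) w)\<rparr>"
  have Y: "is_tree ?Y" using X is_tree_cong[of ?Y X] by simp
  have "ecol (epos_of ?Y) a w = ecol X a w" if e: "edge (epos_of ?Y) a w" for a w
  proof -
    have eX: "edge X a w" using e edge_cong[of "epos_of ?Y" X] by simp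
    have "(THE a. edge X a w) = a"
    proof (rule the_equality)
      show "edge X a w" by (rule eX)
      fix b assume b: "edge X b w"
      have "(a, b) \<in> le X" "(b, a) \<in> le X"
        using edge_lower_unique[OF tree_forest[OF X] b, of a]
          edge_lower_unique[OF tree_forest[OF X] eX, of b] eX b by (auto simp: edge_def)
      then show "b = a" using le_antisym[OF tree_forest[OF X]] by blast
    qed
    then show ?thesis by simp
  qed
  then have "epos_iso (epos_of ?Y) X"
    unfolding epos_iso_def by (intro exI[of _ id]) (simp add: poset_iso_def)
  then have "forget_root (abs_vtree ?Y) = t"
    using t abs_etree_eq_iff[of "epos_of ?Y" X] X Y by (simp add: forget_root_abs[OF Y])
  then show ?thesis by blast
qed

definition root_colour :: "'c vtree \<Rightarrow> 'c" where
  "root_colour x = vcol (rep_vtree x) (root (rep_vtree x))"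

lemma root_colour_abs: "is_tree X \<Longrightarrow> root_colour (abs_vtree X) = vcol X (root X)"
proof -
  assume X: "is_tree X"
  obtain f where f: "poset_iso f X (rep_vtree (abs_vtree X))"
    "\<And>v. v \<in> verts X \<Longrightarrow> vcol X v = vcol (rep_vtree (abs_vtree X)) (f v)"
    using vpos_iso_rep_abs[OF X] unfolding vpos_iso_def by blast
  show ?thesis
    unfolding root_colour_def using f(2)[OF root_verts[OF X]] iso_root[OF f(1) X is_tree_rep_vtree] by simp
qed

text \<open>An isomorphism of the edge-coloured trees respects the colour of each vertex that is not
  the root, since this is the colour of the edge below it. Roots correspond to roots, whose colours
  agree by assumption.\<close>

lemma vtree_eqI:
  assumes "forget_root x = forget_root y" "root_colour x = root_colour y"
  shows "x = y"
proof -
  let ?X = "rep_vtree x" and ?Y = "rep_vtree y"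
  have t: "is_tree ?X" "is_tree ?Y" by (rule is_tree_rep_vtree)+
  have "epos_iso (epos_of ?X) (epos_of ?Y)"
    using assms(1) abs_etree_eq_iff[of "epos_of ?X" "epos_of ?Y"] t by (simp add: forget_root_def)
  then obtain f where f: "poset_iso f (epos_of ?X) (epos_of ?Y)"
    and c: "\<And>v w. edge (epos_of ?X) v w \<Longrightarrow> ecol (epos_of ?X) v w = ecol (epos_of ?Y) (f v) (f w)"
    unfolding epos_iso_def by blast
  have f': "poset_iso f ?X ?Y" using f by (simp add: poset_iso_def)
  have "vcol ?X v = vcol ?Y (f v)" if v: "v \<in> verts ?X" for v
  proof (cases "v = root ?X")
    case True
    then show ?thesis using assms(2) iso_root[OF f' t] by (simp add: root_colour_def)
  next
    case False
    then obtain a where "edge ?X a v"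
      using edge_below[OF tree_forest[OF t(1)] root_le[OF t(1) v]] by metis
    then show ?thesis using c[of a v] by simp
  qed
  then have "vpos_iso ?X ?Y" using f' unfolding vpos_iso_def by blast
  then show ?thesis using abs_vtree_eq_iff[OF t] by simp
qed

section \<open>Changing the colour of the root\<close>

definition root_upd :: "'c \<Rightarrow> 'c vpos \<Rightarrow> 'c vpos" where
  "root_upd i X = X\<lparr>vcol := (vcol X)(root X := i)\<rparr>"

lemma root_upd_simps [simp]:
  "verts (root_upd i X) = verts X" "le (root_upd i X) = le X"
  "vcol (root_upd i X) = (vcol X)(root X := i)"
  by (simp_all add: root_upd_def)

lemma is_tree_root_upd [simp]: "is_tree (root_upd i X) = is_tree X"
  by (rule is_tree_cong) simp_all

lemma root_root_upd [simp]: "root (root_upd i X) = root X"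
  by (rule root_cong) simp_all

lemma recolour_root_eq: "recolour_root i t = abs_vtree (root_upd i (rep_vtree t))"
  by (simp add: recolour_root_def root_upd_def Let_def)

lemma root_colour_recolour_root: "root_colour (recolour_root i t) = i"
  unfolding recolour_root_eq by (simp add: root_colour_abs is_tree_rep_vtree)

lemma forget_root_recolour_root: "forget_root (recolour_root i t) = forget_root t"
proof -
  let ?X = "rep_vtree t"
  have X: "is_tree ?X" by (rule is_tree_rep_vtree)
  have "ecol (epos_of (root_upd i ?X)) a w = ecol (epos_of ?X) a w" if "edge (epos_of (root_upd i ?X)) a w" for a w
    using that edge_root[OF X, of a w] edge_cong[of "root_upd i ?X" ?X] by simp
  then have "epos_iso (epos_of (root_upd i ?X)) (epos_of ?X)"
    unfolding epos_iso_def by (intro exI[of _ id]) (simp add: poset_iso_def)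
  then have "abs_etree (epos_of (root_upd i ?X)) = abs_etree (epos_of ?X)"
    using abs_etree_eq_iff[of "epos_of (root_upd i ?X)" "epos_of ?X"] X by simp
  then show ?thesis
    unfolding recolour_root_eq using X by (simp add: forget_root_abs) (simp add: forget_root_def)
qed

lemma recolour_root_eq_iff: "recolour_root i t = x \<longleftrightarrow> forget_root x = forget_root t \<and> i = root_colour x"
  using vtree_eqI[of "recolour_root i t" x] forget_root_recolour_root[of i t] root_colour_recolour_root[of i t]
  by auto

text \<open>An order automorphism fixes the root and maps the other vertices among themselves, so
  the colour of the root imposes no condition on it. Hence \<open>aut_card\<close> is constant on
  the fibres of \<open>forget_root\<close>.\<close>

lemma aut_card_recolour_root: "aut_card (recolour_root i t) = aut_card t"
proof -
  let ?X = "rep_vtree t"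
  have X: "is_tree ?X" by (rule is_tree_rep_vtree)
  have col: "(\<forall>v\<in>verts ?X. vcol (root_upd i ?X) v = vcol (root_upd i ?X) (f v)) \<longleftrightarrow>
    (\<forall>v\<in>verts ?X. vcol ?X v = vcol ?X (f v))" if f: "poset_iso f ?X ?X" for f
  proof -
    have r: "f (root ?X) = root ?X" by (rule iso_root[OF f X X])
    moreover have "f v \<noteq> root ?X" if "v \<in> verts ?X" "v \<noteq> root ?X" for v
      using f r that root_verts[OF X] unfolding poset_iso_def bij_betw_def inj_on_def by metis
    ultimately show ?thesis by (auto simp: fun_upd_def)
  qed
  have iso: "poset_iso f (root_upd i ?X) (root_upd i ?X) \<longleftrightarrow> poset_iso f ?X ?X" for f
    by (simp add: poset_iso_def)
  have "isos (root_upd i ?X) (root_upd i ?X) = isos ?X ?X"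
    unfolding isos_def using col by (simp only: root_upd_simps(1) iso cong: conj_cong)
  then show ?thesis
    unfolding recolour_root_eq using card_isos[of "root_upd i ?X" "root_upd i ?X"] X
    by (simp add: aut_card_def)
qed

lemma aut_card_cong: "forget_root x = forget_root y \<Longrightarrow> aut_card x = aut_card y"
  using recolour_root_eq_iff[of "root_colour x" y x] aut_card_recolour_root[of "root_colour x" y] by simp

lemma finite_forget_root_vimage:
  fixes T :: "'c::finite etree set"
  assumes "finite T"
  shows "finite {x. forget_root x \<in> T}"
proof -
  have "finite {x. forget_root x = t}" for t :: "'c etree"
  proof -
    obtain y where y: "forget_root y = t" using surj_forget_root by blast
    have "{x. forget_root x = t} \<subseteq> (\<lambda>i. recolour_root i y) ` UNIV"
    proof
      fix x assume "x \<in> {x. forget_root x = t}"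
      then have "recolour_root (root_colour x) y = x" using y by (simp add: recolour_root_eq_iff)
      then show "x \<in> (\<lambda>i. recolour_root i y) ` UNIV" by (metis rangeI)
    qed
    then show ?thesis by (rule finite_subset) simp
  qed
  moreover have "{x. forget_root x \<in> T} = (\<Union>t\<in>T. {x. forget_root x = t})" by blast
  ultimately show ?thesis using assms by simp
qed

lemma lookup_sum_recolour_root:
  fixes t :: "'c::finite vtree"
  shows "Poly_Mapping.lookup (\<Sum>i\<in>UNIV. basis (recolour_root i t) :: _ \<Rightarrow>\<^sub>0 'k::field) x =
    (if forget_root x = forget_root t then 1 else 0)"
  unfolding lookup_sum lookup_basis recolour_root_eq_iff by (cases "forget_root x = forget_root t") simp_all

section \<open>The embedding into the free pre-Lie algebra\<close>

text \<open>It sends \<open>D_t\<close> to the sum of all \<open>x\<close> with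
  \<open>forget_root x = t\<close>, divided by the order of the automorphism group that these
  \<open>x\<close> have in common.\<close>

definition free_embed :: "(('c::finite eforest \<Rightarrow>\<^sub>0 'k::field_char_0) \<Rightarrow> 'k) \<Rightarrow> ('c vtree \<Rightarrow>\<^sub>0 'k)" where
  "free_embed \<xi> = Abs_poly_mapping (\<lambda>x. coef \<xi> (forget_root x) / of_nat (aut_card x))"

lemma lookup_free_embed:
  assumes "\<xi> \<in> prims"
  shows "Poly_Mapping.lookup (free_embed \<xi>) x = coef \<xi> (forget_root x) / of_nat (aut_card x)"
proof -
  have "finite {x. coef \<xi> (forget_root x) / of_nat (aut_card x) \<noteq> 0}"
    by (rule finite_subset[OF _ finite_forget_root_vimage[OF prims_finite[OF assms]]]) auto
  then show ?thesis unfolding free_embed_def by simp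
qed

lemma free_embed_add: "\<xi> \<in> prims \<Longrightarrow> \<eta> \<in> prims \<Longrightarrow> free_embed (\<xi> + \<eta>) = free_embed \<xi> + free_embed \<eta>"
  by (rule poly_mapping_eqI)
    (simp add: lookup_free_embed lookup_add fn.subspace_add[OF subspace_prims] add_divide_distrib)

lemma free_embed_scale: "\<xi> \<in> prims \<Longrightarrow> free_embed (fscale c \<xi>) = pscale c (free_embed \<xi>)"
  by (rule poly_mapping_eqI) (simp add: lookup_free_embed fn.subspace_scale[OF subspace_prims])

lemma inj_on_free_embed:
  "inj_on free_embed (prims :: (('c::finite eforest \<Rightarrow>\<^sub>0 'k::field_char_0) \<Rightarrow> 'k) set)"
proof (rule inj_onI)
  fix \<xi> \<eta> :: "('c eforest \<Rightarrow>\<^sub>0 'k) \<Rightarrow> 'k"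
  assume p: "\<xi> \<in> prims" "\<eta> \<in> prims" and e: "free_embed \<xi> = free_embed \<eta>"
  show "\<xi> = \<eta>"
  proof (rule prims_eqI[OF p])
    fix t :: "'c etree"
    obtain x where x: "forget_root x = t" using surj_forget_root by blast
    show "coef \<xi> t = coef \<eta> t"
      using lookup_free_embed[OF p(1), of x] lookup_free_embed[OF p(2), of x] e x aut_card_pos[of x] by simp
  qed
qed

lemma lookup_lin_ext:
  "Poly_Mapping.lookup (lin_ext f x) y =
    (\<Sum>b\<in>Poly_Mapping.keys x. Poly_Mapping.lookup x b * Poly_Mapping.lookup (f b) y)"
  by (simp add: lin_ext_def lookup_sum)

text \<open>With each coordinate multiplied by the order of the automorphism group, the grafting
  product becomes a convolution over cuts. This is \<open>graft_count\<close> summed over the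
  supports of \<open>f\<close> and \<open>g\<close>, where each cut selects one pair of
  trees.\<close>

lemma lookup_free_prod:
  fixes f g :: "'c vtree \<Rightarrow>\<^sub>0 'k::field_char_0" and y :: "'c vtree"
  defines "Y \<equiv> rep_vtree y"
  shows "Poly_Mapping.lookup (free_prod f g) y * of_nat (aut_card y) =
    (\<Sum>r\<in>verts Y - {root Y}.
      (Poly_Mapping.lookup f (abs_vtree (vlower Y r)) * of_nat (aut_card (abs_vtree (vlower Y r)))) *
      (Poly_Mapping.lookup g (abs_vtree (vupper Y r)) * of_nat (aut_card (abs_vtree (vupper Y r)))))"
proof -
  let ?f = "Poly_Mapping.lookup f" and ?g = "Poly_Mapping.lookup g"
  let ?l = "\<lambda>r. abs_vtree (vlower Y r)" and ?u = "\<lambda>r. abs_vtree (vupper Y r)"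
  let ?N = "\<lambda>x z. card {v \<in> verts (rep_vtree x). abs_vtree (graft (rep_vtree x) v (rep_vtree z)) = y}"
  have N: "(\<Sum>v\<in>verts (rep_vtree x). if abs_vtree (graft (rep_vtree x) v (rep_vtree z)) = y then 1 else 0 :: 'k) =
    of_nat (?N x z)" for x z
    using finite_verts[OF tree_forest[OF is_tree_rep_vtree[of x]]] by (simp add: sum.inter_filter[symmetric])
  have "Poly_Mapping.lookup (free_prod f g) y * of_nat (aut_card y) =
    (\<Sum>x\<in>Poly_Mapping.keys f. \<Sum>z\<in>Poly_Mapping.keys g. ?f x * ?g z * of_nat (?N x z * aut_card y))"
    unfolding free_prod_def lookup_lin_ext lookup_sum lookup_basis N
    by (simp add: sum_distrib_left sum_distrib_right mult.assoc)
  also have "\<dots> = (\<Sum>x\<in>Poly_Mapping.keys f. \<Sum>z\<in>Poly_Mapping.keys g. \<Sum>r\<in>verts Y - {root Y}.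
      if z = ?u r then (if x = ?l r then ?f x * ?g z * (of_nat (aut_card x) * of_nat (aut_card z)) else 0) else 0)"
    unfolding graft_count Y_def[symmetric]
    by (simp only: of_nat_sum sum_distrib_left) (intro sum.cong refl, simp)
  also have "\<dots> = (\<Sum>x\<in>Poly_Mapping.keys f. \<Sum>r\<in>verts Y - {root Y}. \<Sum>z\<in>Poly_Mapping.keys g.
      if z = ?u r then (if x = ?l r then ?f x * ?g z * (of_nat (aut_card x) * of_nat (aut_card z)) else 0) else 0)"
    by (intro sum.cong refl sum.swap)
  also have "\<dots> = (\<Sum>r\<in>verts Y - {root Y}. \<Sum>x\<in>Poly_Mapping.keys f. \<Sum>z\<in>Poly_Mapping.keys g.
      if z = ?u r then (if x = ?l r then ?f x * ?g z * (of_nat (aut_card x) * of_nat (aut_card z)) else 0) else 0)"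
    by (rule sum.swap)
  also have "\<dots> = (\<Sum>r\<in>verts Y - {root Y}. (?f (?l r) * of_nat (aut_card (?l r))) * (?g (?u r) * of_nat (aut_card (?u r))))"
  proof (rule sum.cong[OF refl])
    fix r
    have "(\<Sum>z\<in>Poly_Mapping.keys g. if z = ?u r then
        (if x = ?l r then ?f x * ?g z * (of_nat (aut_card x) * of_nat (aut_card z)) else 0) else 0) =
      (if x = ?l r then ?f x * ?g (?u r) * (of_nat (aut_card x) * of_nat (aut_card (?u r))) else 0)" for x
      by (auto simp: in_keys_iff)
    then show "(\<Sum>x\<in>Poly_Mapping.keys f. \<Sum>z\<in>Poly_Mapping.keys g. if z = ?u r then
        (if x = ?l r then ?f x * ?g z * (of_nat (aut_card x) * of_nat (aut_card z)) else 0) else 0) =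
      (?f (?l r) * of_nat (aut_card (?l r))) * (?g (?u r) * of_nat (aut_card (?u r)))"
      by (auto simp: in_keys_iff)
  qed
  finally show ?thesis .
qed

text \<open>The rescaled coordinates of \<open>free_embed \<xi>\<close> are the coordinates of
  \<open>\<xi>\<close> at \<open>forget_root x\<close>, so both sides become convolutions over cuts.
  They have the same cuts because, with all colours allowed, every vertex other than the root is
  admissible.\<close>

lemma free_embed_prod:
  fixes q1 q2 :: "'c::finite \<Rightarrow> 'k::field_char_0"
  assumes q1: "\<And>j. q1 j = 1" and q2: "\<And>j. q2 j = 0" and p: "\<xi> \<in> prims" "\<eta> \<in> prims"
  shows "free_embed (prim_prod q1 q2 \<xi> \<eta>) = free_prod (free_embed \<xi>) (free_embed \<eta>)"
proof (rule poly_mapping_eqI)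
  fix y :: "'c vtree"
  define Y where "Y = rep_vtree y"
  have Y: "is_tree Y" by (simp add: Y_def is_tree_rep_vtree)
  have q1': "q1 j = (if j \<in> UNIV then 1 else 0)" for j using q1 by simp
  let ?l = "\<lambda>r. abs_vtree (vlower Y r)" and ?u = "\<lambda>r. abs_vtree (vupper Y r)"
  have emb: "Poly_Mapping.lookup (free_embed \<zeta>) x * of_nat (aut_card x) = coef \<zeta> (forget_root x)"
    if "\<zeta> \<in> prims" for \<zeta> :: "('c eforest \<Rightarrow>\<^sub>0 'k) \<Rightarrow> 'k" and x
    using that aut_card_pos[of x] by (simp add: lookup_free_embed)
  have "coef (prim_prod q1 q2 \<xi> \<eta>) (forget_root y) = cut_sum UNIV (\<lambda>t s. coef \<xi> t * coef \<eta> s) (epos_of Y)"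
    unfolding coef_prim_prod[of q1 UNIV q2, OF q1' q2 p] forget_root_def Y_def
    by (rule cut_sum_rep) (simp add: is_tree_rep_vtree)
  also have "\<dots> = (\<Sum>r\<in>verts Y - {root Y}. coef \<xi> (forget_root (?l r)) * coef \<eta> (forget_root (?u r)))"
    unfolding cut_sum_def
    by (intro sum.cong)
      (auto simp: admissible_def elower_epos_of eupper_epos_of forget_root_abs is_tree_vlower[OF Y] is_tree_vupper[OF tree_forest[OF Y]])
  also have "\<dots> = Poly_Mapping.lookup (free_prod (free_embed \<xi>) (free_embed \<eta>)) y * of_nat (aut_card y)"
    unfolding lookup_free_prod Y_def[symmetric] emb[OF p(1)] emb[OF p(2)] ..
  finally show "Poly_Mapping.lookup (free_embed (prim_prod q1 q2 \<xi> \<eta>)) y =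
    Poly_Mapping.lookup (free_prod (free_embed \<xi>) (free_embed \<eta>)) y"
    unfolding lookup_free_embed[OF prim_prod_prims[of q1 UNIV q2, OF q1' q2 p]] using aut_card_pos[of y] by simp
qed

lemma free_embed_image:
  "free_embed ` (prims :: (('c::finite eforest \<Rightarrow>\<^sub>0 'k::field_char_0) \<Rightarrow> 'k) set) =
    module.span pscale {\<Sum>i\<in>UNIV. basis (recolour_root i t) | t. True}"
proof (intro equalityI)
  let ?S = "{\<Sum>i\<in>UNIV. basis (recolour_root i t) | t. True} :: ('c vtree \<Rightarrow>\<^sub>0 'k) set"
  let ?P = "prims :: (('c eforest \<Rightarrow>\<^sub>0 'k) \<Rightarrow> 'k) set"
  show "free_embed ` ?P \<subseteq> module.span pscale ?S"
  proof (rule image_subsetI)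
    fix \<xi> :: "('c eforest \<Rightarrow>\<^sub>0 'k) \<Rightarrow> 'k" assume \<xi>: "\<xi> \<in> prims"
    \<comment> \<open>A section of \<open>forget_root\<close>: one vertex-coloured tree for each
      edge-coloured one. The generator attached to \<open>g t\<close> sums over the whole fibre
      above \<open>t\<close>.\<close>
    obtain g :: "'c etree \<Rightarrow> 'c vtree" where g: "\<And>t. forget_root (g t) = t" using surj_forget_root by metis
    let ?T = "{t. coef \<xi> t \<noteq> 0}"
    have "free_embed \<xi> = (\<Sum>t\<in>?T. pscale (coef \<xi> t / of_nat (aut_card (g t)))
        (\<Sum>i\<in>UNIV. basis (recolour_root i (g t))))"
    proof (rule poly_mapping_eqI)
      fix x
      have "aut_card (g (forget_root x)) = aut_card x" by (rule aut_card_cong) (rule g)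
      then show "Poly_Mapping.lookup (free_embed \<xi>) x = Poly_Mapping.lookup (\<Sum>t\<in>?T.
          pscale (coef \<xi> t / of_nat (aut_card (g t))) (\<Sum>i\<in>UNIV. basis (recolour_root i (g t)))) x"
        unfolding lookup_free_embed[OF \<xi>] lookup_sum[of _ ?T] lookup_pscale lookup_sum_recolour_root g
        using prims_finite[OF \<xi>] by (simp add: if_distrib[of "\<lambda>y. _ * y"] cong: if_cong)
    qed
    also have "\<dots> \<in> pm.span ?S"
      by (intro pm.span_sum pm.span_scale pm.span_base) blast
    finally show "free_embed \<xi> \<in> pm.span ?S" .
  qed
  show "module.span pscale ?S \<subseteq> free_embed ` ?P"
  proof (rule pm.span_minimal)
    show "pm.subspace (free_embed ` ?P)"
      unfolding pm.subspace_def
    proof (intro conjI ballI allI)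
      have z: "(0 :: ('c eforest \<Rightarrow>\<^sub>0 'k) \<Rightarrow> 'k) \<in> prims" by (rule fn.subspace_0[OF subspace_prims])
      have "free_embed (0 :: ('c eforest \<Rightarrow>\<^sub>0 'k) \<Rightarrow> 'k) = 0"
        by (rule poly_mapping_eqI) (simp add: lookup_free_embed[OF z] coef_def)
      then show "0 \<in> free_embed ` ?P" using z by (metis imageI)
      fix a b c assume a: "a \<in> free_embed ` ?P"
      then show "pscale c a \<in> free_embed ` ?P"
        using free_embed_scale fn.subspace_scale[OF subspace_prims] by (metis (no_types, lifting) imageE imageI)
      assume "b \<in> free_embed ` ?P"
      then show "a + b \<in> free_embed ` ?P"
        using a free_embed_add fn.subspace_add[OF subspace_prims] by (metis (no_types, lifting) imageE imageI)
    qed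
    show "?S \<subseteq> free_embed ` ?P"
    proof clarify
      fix t :: "'c vtree"
      \<comment> \<open>The scalar cancels the denominator in \<open>free_embed\<close>, which
        leaves coefficient \<open>1\<close> on each recolouring of \<open>t\<close>.\<close>
      let ?\<xi> = "fscale (of_nat (aut_card t)) (D_tree (forget_root t)) :: ('c eforest \<Rightarrow>\<^sub>0 'k) \<Rightarrow> 'k"
      have \<xi>: "?\<xi> \<in> prims" by (intro fn.subspace_scale[OF subspace_prims] D_tree_prims)
      have "free_embed ?\<xi> = (\<Sum>i\<in>UNIV. basis (recolour_root i t))"
      proof (rule poly_mapping_eqI)
        fix x
        show "Poly_Mapping.lookup (free_embed ?\<xi>) x = Poly_Mapping.lookup (\<Sum>i\<in>UNIV. basis (recolour_root i t)) x"
          unfolding lookup_free_embed[OF \<xi>] lookup_sum_recolour_root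
          using aut_card_pos[of t] aut_card_cong[of x t] by (auto simp: coef_D_tree)
      qed
      then show "(\<Sum>i\<in>UNIV. basis (recolour_root i t)) \<in> free_embed ` ?P" using \<xi> by (metis imageI)
    qed
  qed
qed

theorem theorem5p2:
  fixes p :: "'c::finite set"
    and q1 q2 :: "'c \<Rightarrow> 'k::field_char_0"
  assumes "\<And>j. q1 j = (if j \<in> p then 1 else 0)"
    and "\<And>j. q2 j = 0"
  shows "(\<forall>t s. prim_prod q1 q2 (D_tree t) (D_tree s) =
             Sum_any (\<lambda>w. fscale (cut_coeff q1 q2 t s w) (D_tree w)))
       \<and> pre_lie_algebra fscale (dual_primitives (tree_hopf q1 q2)) (prim_prod q1 q2)
       \<and> (p = UNIV \<longrightarrow>
            (\<exists>\<phi> :: (('c eforest \<Rightarrow>\<^sub>0 'k) \<Rightarrow> 'k) \<Rightarrow> ('c vtree \<Rightarrow>\<^sub>0 'k).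
               pre_lie_hom fscale (dual_primitives (tree_hopf q1 q2)) (prim_prod q1 q2)
                 pscale UNIV free_prod \<phi>
             \<and> inj_on \<phi> (dual_primitives (tree_hopf q1 q2))
             \<and> \<phi> ` dual_primitives (tree_hopf q1 q2) =
                 module.span pscale {\<Sum>i\<in>p. basis (recolour_root i t) | t. True}))"
proof (intro conjI allI impI)
  show "prim_prod q1 q2 (D_tree t) (D_tree s) =
    Sum_any (\<lambda>w. fscale (cut_coeff q1 q2 t s w) (D_tree w))" for t s
    by (rule prim_prod_D_tree[of q1 p q2, OF assms])
  show "pre_lie_algebra fscale (dual_primitives (tree_hopf q1 q2)) (prim_prod q1 q2)"
    unfolding dual_primitives_eq by (rule pre_lie_prims[of q1 p q2, OF assms])
  assume p: "p = UNIV"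
  then have q: "q1 j = 1" "q2 j = 0" for j using assms by simp_all
  show "\<exists>\<phi> :: (('c eforest \<Rightarrow>\<^sub>0 'k) \<Rightarrow> 'k) \<Rightarrow> ('c vtree \<Rightarrow>\<^sub>0 'k).
      pre_lie_hom fscale (dual_primitives (tree_hopf q1 q2)) (prim_prod q1 q2) pscale UNIV free_prod \<phi>
      \<and> inj_on \<phi> (dual_primitives (tree_hopf q1 q2))
      \<and> \<phi> ` dual_primitives (tree_hopf q1 q2) =
        module.span pscale {\<Sum>i\<in>p. basis (recolour_root i t) | t. True}"
    unfolding dual_primitives_eq p
  proof (intro exI[of _ free_embed] conjI)
    show "pre_lie_hom fscale prims (prim_prod q1 q2) pscale UNIV free_prod free_embed"
      unfolding pre_lie_hom_def
      using free_embed_add free_embed_scale free_embed_prod[of q1 q2, OF q] by blast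
  qed (rule inj_on_free_embed, rule free_embed_image)
qed

end
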